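(* Let $T$ be a caterpillar with diameter $d$ and let $P: v_0, v_1, \ldots, v_d$ be a diametrical path of $T$ (a path of length $d=\operatorname{diam}(T)$). Then $\Gamma_b(T) = \operatorname{diam}(T)$ if and only if all of the following hold: (i) each $v_i$, $i \in \{1, \ldots, d-1\}$, is adjacent to at most two leaves; (ii) for any $i \in \{1, \ldots, d-2\}$, $\min\{\deg_T(v_i), \deg_T(v_{i+1})\} = 2$; (iii) whenever $v_i$ and $v_j$ with $i < j$ are each adjacent to at least two leaves, there exists an index $k$ with $i < k < j$ such that $\deg_T(v_k) = \deg_T(v_{k+1}) = 2$.
   Context: All graphs are finite, simple, connected and nontrivial. A caterpillar is a tree of order at least three whose removal of all leaves yields a path. For a graph $G=(V,E)$, a broadcast is a function $f: V \to \{0,1,\ldots,\operatorname{diam}(G)\}$ with $f(v) \le e(v)$ (the eccentricity of $v$) for all $v$. It is dominating if every $u \in V$ is at distance at most $f(v)$ from some $v$ with $f(v) \ge 1$. It is minimal dominating if it is dominating and no broadcast $f' \ne f$ with $f'(v)\le f(v)$ for all $v$ is dominating. The cost of $f$ is $\sigma(f)=\sum_{v\in V} f(v)$, and the upper broadcast domination number is $\Gamma_b(G)=\max\{\sigma(f): f \text{ is a minimal dominating broadcast on } G\}$. *)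

theory Defs
  imports "Graph_Theory.Graph_Theory" "HOL-Library.FuncSet"
begin

text \<open>A finite simple graph is a \<^term>\<open>graph G\<close> in the sense of \<^theory>\<open>Graph_Theory.Digraph\<close>:
  a finite symmetric digraph without loops or parallel arcs. An edge is thus a pair of
  opposite arcs, and the degree of a vertex is its out-degree.\<close>

abbreviation deg :: "('a, 'b) pre_digraph \<Rightarrow> 'a \<Rightarrow> nat" where
  "deg \<equiv> out_degree"

definition leaves :: "('a, 'b) pre_digraph \<Rightarrow> 'a set" where
  "leaves G = {v \<in> verts G. deg G v = 1}"

definition adjacent_leaves :: "('a, 'b) pre_digraph \<Rightarrow> 'a \<Rightarrow> 'a set" where
  "adjacent_leaves G v = {l \<in> leaves G. v \<rightarrow>\<^bsub>G\<^esub> l}"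

text \<open>\<^const>\<open>Digraph_Component.tree\<close> is not usable here: as a symmetric digraph,
  every graph with an edge has a directed cycle of length 2. The undirected cycles are exactly the
  directed ones of length at least 3. Connectedness includes having at least one vertex.\<close>

definition undirected_tree :: "('a, 'b) pre_digraph \<Rightarrow> bool" where
  "undirected_tree G \<longleftrightarrow> graph G \<and> Digraph_Component.connected G
     \<and> \<not> (\<exists>p. pre_digraph.cycle G p \<and> length p \<ge> 3)"

text \<open>Paths as graphs; a single vertex counts as a path, so that stars are caterpillars.\<close>

definition path_graph :: "('a, 'b) pre_digraph \<Rightarrow> bool" where
  "path_graph G \<longleftrightarrow> graph G \<and>
     (\<exists>p. p \<noteq> [] \<and> distinct p \<and> verts G = set p \<and>
       (\<forall>u v. u \<rightarrow>\<^bsub>G\<^esub> v \<longleftrightarrow> (\<exists>i. Suc i < length p \<and> {u, v} = {p ! i, p ! Suc i})))"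

definition caterpillar :: "('a, 'b) pre_digraph \<Rightarrow> bool" where
  "caterpillar G \<longleftrightarrow> undirected_tree G \<and> card (verts G) \<ge> 3
     \<and> path_graph (G \<restriction> (verts G - leaves G))"

text \<open>The notions below are meant for connected graphs with at least two vertices, where the
  \<^term>\<open>Least\<close> and \<^term>\<open>Max\<close> are attained.\<close>

definition graph_dist :: "('a, 'b) pre_digraph \<Rightarrow> 'a \<Rightarrow> 'a \<Rightarrow> nat" where
  "graph_dist G u v = (LEAST n. \<exists>p. vwalk p G \<and> hd p = u \<and> last p = v \<and> vwalk_length p = n)"

definition eccentricity :: "('a, 'b) pre_digraph \<Rightarrow> 'a \<Rightarrow> nat" where
  "eccentricity G v = Max (graph_dist G v ` verts G)"

definition diam :: "('a, 'b) pre_digraph \<Rightarrow> nat" where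
  "diam G = Max (eccentricity G ` verts G)"

text \<open>Broadcasts are extensional functions on the vertex set, so that HOL equality of
  broadcasts is equality on the vertices.\<close>

definition broadcast :: "('a, 'b) pre_digraph \<Rightarrow> ('a \<Rightarrow> nat) \<Rightarrow> bool" where
  "broadcast G f \<longleftrightarrow> f \<in> verts G \<rightarrow>\<^sub>E {0..diam G} \<and> (\<forall>v\<in>verts G. f v \<le> eccentricity G v)"

definition dominating_broadcast :: "('a, 'b) pre_digraph \<Rightarrow> ('a \<Rightarrow> nat) \<Rightarrow> bool" where
  "dominating_broadcast G f \<longleftrightarrow> broadcast G f \<and>
     (\<forall>u\<in>verts G. \<exists>v\<in>verts G. f v \<ge> 1 \<and> graph_dist G u v \<le> f v)"

definition minimal_dominating_broadcast :: "('a, 'b) pre_digraph \<Rightarrow> ('a \<Rightarrow> nat) \<Rightarrow> bool" where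
  "minimal_dominating_broadcast G f \<longleftrightarrow> dominating_broadcast G f \<and>
     \<not> (\<exists>g. g \<noteq> f \<and> (\<forall>v\<in>verts G. g v \<le> f v) \<and> dominating_broadcast G g)"

definition cost :: "('a, 'b) pre_digraph \<Rightarrow> ('a \<Rightarrow> nat) \<Rightarrow> nat" where
  "cost G f = (\<Sum>v\<in>verts G. f v)"

definition upper_broadcast_number :: "('a, 'b) pre_digraph \<Rightarrow> nat" where
  "upper_broadcast_number G = Max {cost G f | f. minimal_dominating_broadcast G f}"

end

theory Submission
  imports Defs
begin

text \<open>
  A dominating broadcast \<open>f\<close> is minimal iff every \<open>v\<close> with \<open>f v \<ge> 1\<close> has a private neighbour: a vertex
  dominated by \<open>v\<close> only and at distance \<open>f v\<close> from it (any distance at most 1 if \<open>f v = 1\<close>). Along the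
  diametrical path every vertex has a position, and a height, which is 1 for the leaves off the path; the
  distance of two distinct vertices is the difference of the positions plus both heights.

  Under the three conditions, charge each broadcasting vertex \<open>v\<close> to \<open>f v\<close> of the \<open>d\<close> edges of the
  path, injectively. If \<open>v\<close> and its private neighbour are distinct, take the edges between
  them, extended by one edge beyond each end that lies off the path. Otherwise \<open>f v = 1\<close>, and
  \<open>v\<close> takes one of the two edges at its position. Condition (ii) separates the extended intervals;
  condition (iii) lets the choice between the left and the right edge be made consistently, since a
  run of such vertices at consecutive positions contains at most one position with two leaves.

  Conversely, each violation yields a minimal dominating broadcast of cost more than \<open>d\<close>: the two
  ends of the path broadcast towards the offending place, where (for (i) and (iii)) an independent
  set of vertices broadcasts with value 1.
\<close>

section \<open>Degrees and distances in digraphs\<close>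

lemma (in nomulti_digraph) out_degree_eq_card: "out_degree G v = card {w. v \<rightarrow>\<^bsub>G\<^esub> w}"
proof -
  have "head G ` out_arcs G v = {w. v \<rightarrow>\<^bsub>G\<^esub> w}"
    by (auto simp: arcs_ends_conv)
  moreover have "inj_on (head G) (out_arcs G v)"
    by (intro inj_onI no_multi_arcs) (auto simp: arc_to_ends_def)
  ultimately show ?thesis
    unfolding out_degree_def by (metis card_image)
qed

text \<open>\<open>D\<close> acts as a potential with target \<open>y\<close>. By \<open>lip\<close>
  a walk to \<open>y\<close> loses at most one unit per step, so it has at least \<open>D x\<close>
  steps; following \<open>descent\<close> greedily gives a walk with exactly that many.\<close>

lemma (in wf_digraph) graph_dist_eqI:
  fixes D :: "'a \<Rightarrow> nat"
  assumes y: "y \<in> verts G" "D y = 0"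
    and lip: "\<And>u v. u \<rightarrow>\<^bsub>G\<^esub> v \<Longrightarrow> D u \<le> D v + 1"
    and descent: "\<And>u. u \<in> verts G \<Longrightarrow> u \<noteq> y \<Longrightarrow> \<exists>v. u \<rightarrow>\<^bsub>G\<^esub> v \<and> D u = D v + 1"
    and x: "x \<in> verts G"
  shows "graph_dist G x y = D x"
  unfolding graph_dist_def
proof (rule Least_equality)
  have "u \<in> verts G \<Longrightarrow> D u = n \<Longrightarrow> \<exists>p. vwalk p G \<and> hd p = u \<and> last p = y \<and> length p = Suc n" for n u
  proof (induction n arbitrary: u)
    case 0
    with descent have "u = y" by fastforce
    then show ?case using y by (intro exI[of _ "[y]"]) auto
  next
    case (Suc n)
    then have "u \<noteq> y" using y by auto
    then obtain v where v: "u \<rightarrow>\<^bsub>G\<^esub> v" "D v = n" using descent Suc.prems by fastforce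
    then obtain p where p: "vwalk p G" "hd p = v" "last p = y" "length p = Suc n"
      using Suc.IH adj_in_verts by blast
    then have "vwalk (u # p) G" using Suc.prems v by (intro vwalk_consI) auto
    then show ?case using p by (intro exI[of _ "u # p"]) auto
  qed
  then show "\<exists>p. vwalk p G \<and> hd p = x \<and> last p = y \<and> vwalk_length p = D x"
    using x by fastforce
next
  have "vwalk p G \<Longrightarrow> last p = y \<Longrightarrow> D (hd p) \<le> length p - 1" for p
  proof (induction p rule: vwalk_induct)
    case (Cons u v es)
    then have "D v \<le> length (v # es) - 1" by simp
    then show ?case using lip[OF Cons(1)] by simp
  qed (use y in auto)
  then show "\<And>n. \<exists>p. vwalk p G \<and> hd p = x \<and> last p = y \<and> vwalk_length p = n \<Longrightarrow> D x \<le> n"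
    by auto
qed

lemma vwalk_nth_adjacent: "vwalk p G \<Longrightarrow> Suc i < length p \<Longrightarrow> p ! i \<rightarrow>\<^bsub>G\<^esub> p ! Suc i"
proof (induction arbitrary: i rule: vwalk_induct)
  case (Cons u v es)
  then show ?case by (cases i) auto
qed auto

subsection \<open>Coordinates along a path\<close>

text \<open>The setting speaks of indices only, so that distances and degrees become arithmetic.
  \<open>diametrical_caterpillar_path\<close> shows that every diametrical path of a caterpillar
  fits it.\<close>

locale caterpillar_path = graph T for T :: "('a, 'b) pre_digraph" (structure) +
  fixes P :: "'a list" and d :: nat
  assumes length_P: "length P = d + 1" and d_ge_2: "2 \<le> d"
    and distinct_P: "distinct P" and P_verts: "set P \<subseteq> verts T"
    and adj_P: "\<And>i j. i \<le> d \<Longrightarrow> j \<le> d \<Longrightarrow> P ! i \<rightarrow>\<^bsub>T\<^esub> P ! j \<longleftrightarrow> j = i + 1 \<or> i = j + 1"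
    and off_P: "\<And>x. x \<in> verts T \<Longrightarrow> x \<notin> set P \<Longrightarrow> \<exists>i\<ge>1. i < d \<and> (\<forall>y. x \<rightarrow>\<^bsub>T\<^esub> y \<longleftrightarrow> y = P ! i)"
begin

definition pos :: "'a \<Rightarrow> nat" where
  "pos x = (if x \<in> set P then THE i. i \<le> d \<and> P ! i = x
    else SOME i. 1 \<le> i \<and> i < d \<and> (\<forall>y. x \<rightarrow>\<^bsub>T\<^esub> y \<longleftrightarrow> y = P ! i))"

text \<open>A number rather than a predicate, so that it enters distances as a summand.\<close>

definition height :: "'a \<Rightarrow> nat" where
  "height x = of_bool (x \<notin> set P)"

definition pendant :: "nat \<Rightarrow> 'a set" where
  "pendant i = {x \<in> verts T. height x = 1 \<and> pos x = i}"

lemma nth_in_verts: "i \<le> d \<Longrightarrow> P ! i \<in> verts T"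
  using P_verts length_P by auto

lemma pos_nth [simp]: "i \<le> d \<Longrightarrow> pos (P ! i) = i"
  unfolding pos_def using distinct_P length_P
  by (auto intro!: the_equality simp: nth_eq_iff_index_eq)

lemma height_nth [simp]: "i \<le> d \<Longrightarrow> height (P ! i) = 0"
  unfolding height_def using length_P by auto

lemma nth_eq_iff [simp]: "i \<le> d \<Longrightarrow> j \<le> d \<Longrightarrow> P ! i = P ! j \<longleftrightarrow> i = j"
  using pos_nth by metis

lemma height_le_1: "height x \<le> 1"
  by (simp add: height_def)

lemma on_path: "x \<in> verts T \<Longrightarrow> height x = 0 \<Longrightarrow> pos x \<le> d \<and> P ! pos x = x"
  unfolding height_def using length_P by (auto simp: in_set_conv_nth)

lemma off_path:
  assumes "x \<in> verts T" "height x \<noteq> 0"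
  shows "height x = 1" "1 \<le> pos x" "pos x < d" "x \<rightarrow>\<^bsub>T\<^esub> y \<longleftrightarrow> y = P ! pos x"
proof -
  have x: "x \<notin> set P" using assms by (auto simp: height_def)
  show "height x = 1" using x by (simp add: height_def)
  have "1 \<le> pos x \<and> pos x < d \<and> (\<forall>y. x \<rightarrow>\<^bsub>T\<^esub> y \<longleftrightarrow> y = P ! pos x)"
    unfolding pos_def if_not_P[OF x] by (rule someI_ex) (use off_P[OF assms(1) x] in blast)
  then show "1 \<le> pos x" "pos x < d" "x \<rightarrow>\<^bsub>T\<^esub> y \<longleftrightarrow> y = P ! pos x" by auto
qed

lemma pos_le: "x \<in> verts T \<Longrightarrow> pos x \<le> d"
  using on_path[of x] off_path(3)[of x] by (cases "height x = 0") auto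

lemma adj_commute: "x \<rightarrow>\<^bsub>T\<^esub> y \<longleftrightarrow> y \<rightarrow>\<^bsub>T\<^esub> x"
  using arcs_ends_symmetric[OF sym_arcs] by blast

text \<open>One of the two truncated differences is always 0, so their sum is the absolute
  difference of the positions. For an off-path vertex, total 1 leaves only its foot on the path as a
  neighbour.\<close>

lemma adj_iff:
  assumes "x \<in> verts T" "y \<in> verts T"
  shows "x \<rightarrow>\<^bsub>T\<^esub> y \<longleftrightarrow> (pos x - pos y) + (pos y - pos x) + height x + height y = 1"
proof -
  have off: "x \<rightarrow>\<^bsub>T\<^esub> y \<longleftrightarrow> (pos x - pos y) + (pos y - pos x) + height x + height y = 1"
    if "x \<in> verts T" "y \<in> verts T" "height x \<noteq> 0" for x y
  proof
    assume "x \<rightarrow>\<^bsub>T\<^esub> y"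
    then have "y = P ! pos x" using off_path(4)[OF that(1,3)] by simp
    then show "(pos x - pos y) + (pos y - pos x) + height x + height y = 1"
      using off_path(1,3)[OF that(1,3)] by simp
  next
    assume *: "(pos x - pos y) + (pos y - pos x) + height x + height y = 1"
    then have "height y = 0" "pos y = pos x" using that(3) by simp_all
    then have "y = P ! pos x" using on_path[OF that(2)] by simp
    then show "x \<rightarrow>\<^bsub>T\<^esub> y" using off_path(4)[OF that(1,3)] by simp
  qed
  show ?thesis
  proof (cases "height x = 0 \<and> height y = 0")
    case True
    then have "x \<rightarrow>\<^bsub>T\<^esub> y \<longleftrightarrow> pos y = pos x + 1 \<or> pos x = pos y + 1"
      using adj_P[of "pos x" "pos y"] on_path[OF assms(1)] on_path[OF assms(2)] by metis
    then show ?thesis using True by linarith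
  next
    case False
    then consider "height x \<noteq> 0" | "height y \<noteq> 0" by linarith
    then show ?thesis
    proof cases
      case 1
      then show ?thesis using off assms by blast
    next
      case 2
      then show ?thesis unfolding adj_commute[of x y] off[OF assms(2,1) 2] by linarith
    qed
  qed
qed

lemma on_path_inj: "x \<in> verts T \<Longrightarrow> y \<in> verts T \<Longrightarrow> height x = 0 \<Longrightarrow> height y = 0 \<Longrightarrow>
    pos x = pos y \<Longrightarrow> x = y"
  using on_path by metis

text \<open>The equal case is separate because the sum would give 2 for an off-path leaf and itself.
  The potential descends by stepping down to the path, along it towards \<open>pos y\<close>, and
  finally up to \<open>y\<close>.\<close>

lemma graph_dist_eq:
  assumes x: "x \<in> verts T" and y: "y \<in> verts T"
  shows "graph_dist T x y =
    (if x = y then 0 else (pos x - pos y) + (pos y - pos x) + height x + height y)"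
proof -
  define D where "D x = (if x = y then 0
    else (pos x - pos y) + (pos y - pos x) + height x + height y)" for x
  have "graph_dist T x y = D x"
  proof (rule graph_dist_eqI)
    fix u v assume uv: "u \<rightarrow>\<^bsub>T\<^esub> v"
    then show "D u \<le> D v + 1"
      using adj_iff[of u v] adj_in_verts[OF uv] by (auto simp: D_def)
  next
    fix u assume u: "u \<in> verts T" "u \<noteq> y"
    have step: "\<exists>v. u \<rightarrow>\<^bsub>T\<^esub> v \<and> D u = D v + 1"
      if "v \<in> verts T" "height v = 0 \<or> v = y"
        "(pos u - pos v) + (pos v - pos u) + height u + height v = 1"
        "v = y \<or> (pos u - pos y) + (pos y - pos u) + height u = (pos v - pos y) + (pos y - pos v) + height v + 1" for v
    proof -
      have "u \<rightarrow>\<^bsub>T\<^esub> v" using adj_iff[OF u(1) that(1)] that(3) by simp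
      moreover have "D u = D v + 1"
        using that u(2) by (cases "v = y") (simp_all add: D_def)
      ultimately show ?thesis by blast
    qed
    consider "height u \<noteq> 0" | "height u = 0" "pos u < pos y" | "height u = 0" "pos u > pos y"
      | "height u = 0" "pos u = pos y" by linarith
    then show "\<exists>v. u \<rightarrow>\<^bsub>T\<^esub> v \<and> D u = D v + 1"
    proof cases
      case 1
      then show ?thesis
        using off_path(1,3)[OF u(1) 1] by (intro step[of "P ! pos u"]) (simp_all add: nth_in_verts)
    next
      case 2
      then show ?thesis
        using pos_le[OF y]
        by (intro step[of "P ! (pos u + 1)"]) (simp_all add: nth_in_verts Suc_diff_Suc)
    next
      case 3
      then show ?thesis
        using pos_le[OF u(1)] by (intro step[of "P ! (pos u - 1)"]) (simp_all add: nth_in_verts, linarith)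
    next
      case 4
      then have "height y = 1" using on_path_inj[OF u(1) y] u(2) height_le_1[of y] by linarith
      then show ?thesis using 4 y by (intro step[of y]) simp_all
    qed
  qed (use x y in \<open>auto simp: D_def\<close>)
  then show ?thesis by (simp add: D_def)
qed

lemma graph_dist_le: "x \<in> verts T \<Longrightarrow> y \<in> verts T \<Longrightarrow> graph_dist T x y \<le> d"
  using pos_le[of x] pos_le[of y] off_path[of x] off_path[of y] d_ge_2
  by (cases "height x = 0"; cases "height y = 0") (auto simp: graph_dist_eq)

lemma eccentricity_ge: "x \<in> verts T \<Longrightarrow> y \<in> verts T \<Longrightarrow> graph_dist T x y \<le> eccentricity T x"
  unfolding eccentricity_def by (intro Max_ge) auto

lemma eccentricity_le: "x \<in> verts T \<Longrightarrow> eccentricity T x \<le> d"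
  unfolding eccentricity_def using graph_dist_le by (subst Max_le_iff) auto

lemma eccentricity_ends: "eccentricity T (P ! 0) = d" "eccentricity T (P ! d) = d"
proof -
  show "eccentricity T (P ! 0) = d" "eccentricity T (P ! d) = d"
    using eccentricity_ge[of "P ! 0" "P ! d"] eccentricity_ge[of "P ! d" "P ! 0"]
      eccentricity_le[of "P ! 0"] eccentricity_le[of "P ! d"]
      d_ge_2 by (auto simp: nth_in_verts graph_dist_eq)
qed

text \<open>Makes the value 1 admissible at every vertex, as needed in
  \<open>ex_costly_broadcast_if_alternating_block\<close>.\<close>

lemma eccentricity_pos:
  assumes "x \<in> verts T" shows "1 \<le> eccentricity T x"
proof -
  obtain y where y: "y \<in> verts T" "graph_dist T x y \<ge> 1"
  proof (cases "x = P ! 0")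
    case True
    then show ?thesis using that[of "P ! d"] d_ge_2
      by (auto simp: graph_dist_eq nth_in_verts)
  next
    case False
    then show ?thesis using that[of "P ! 0"] assms on_path[of x] not_less_eq_eq[of 1 "pos x"]
      by (cases "height x = 0") (auto simp: graph_dist_eq nth_in_verts)
  qed
  then show ?thesis using eccentricity_ge[OF assms y(1)] by linarith
qed

text \<open>The locale fixes only the length of \<open>P\<close>. Since \<open>d\<close> thereby
  becomes an invariant of the graph, any one path of this kind computes the diameter.\<close>

lemma diam_eq: "diam T = d"
  unfolding diam_def using eccentricity_ends(1) nth_in_verts[of 0] eccentricity_le
  by (intro Max_eqI) (auto intro: rev_image_eqI)

lemma nth_not_pendant [simp]: "i \<le> d \<Longrightarrow> P ! i \<notin> pendant j"
  by (simp add: pendant_def)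

lemma pendant_finite [simp]: "finite (pendant i)"
  by (simp add: pendant_def)

lemma deg_on_path:
  assumes "1 \<le> i" "i < d"
  shows "deg T (P ! i) = card (pendant i) + 2"
proof -
  have nbs: "{y. P ! i \<rightarrow>\<^bsub>T\<^esub> y} = insert (P ! (i - 1)) (insert (P ! (i + 1)) (pendant i))" (is "_ = ?N")
  proof (rule set_eqI, rule iffI)
    fix y assume "y \<in> {y. P ! i \<rightarrow>\<^bsub>T\<^esub> y}"
    then have y: "y \<in> verts T" "P ! i \<rightarrow>\<^bsub>T\<^esub> y" using adj_in_verts by auto
    then have "(i - pos y) + (pos y - i) + height y = 1"
      using adj_iff[of "P ! i" y] nth_in_verts[of i] assms by auto
    then consider "height y = 1" "pos y = i" | "height y = 0" "pos y = i - 1" | "height y = 0" "pos y = i + 1"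
      by linarith
    then show "y \<in> ?N" using on_path[of y] y by cases (auto simp: pendant_def)
  next
    fix y assume "y \<in> ?N"
    then show "y \<in> {y. P ! i \<rightarrow>\<^bsub>T\<^esub> y}" using assms
      by (auto simp: adj_P pendant_def adj_iff nth_in_verts)
  qed
  have "P ! (i - 1) \<notin> insert (P ! (i + 1)) (pendant i)" "P ! (i + 1) \<notin> pendant i"
    using assms by simp_all
  then have "card ?N = card (pendant i) + 2" by simp
  then show ?thesis by (simp only: out_degree_eq_card nbs)
qed

lemma deg_off_path: "x \<in> verts T \<Longrightarrow> height x \<noteq> 0 \<Longrightarrow> deg T x = 1"
  by (simp add: out_degree_eq_card off_path(4))

lemma deg_ends: "deg T (P ! 0) = 1" "deg T (P ! d) = 1"
proof -
  \<comment> \<open>\<open>j\<close> is the only position next to the end \<open>i\<close>: 1 for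
    the left end and \<open>d - 1\<close> for the right one.\<close>
  have *: "deg T (P ! i) = 1" if i: "i \<le> d" "j \<le> d" "\<And>k. k \<le> d \<Longrightarrow> i = k + 1 \<or> k = i + 1 \<longleftrightarrow> k = j"
    "i = 0 \<or> i = d" for i j
  proof -
    have "P ! i \<rightarrow>\<^bsub>T\<^esub> y \<longleftrightarrow> y = P ! j" for y
    proof
      assume adj: "P ! i \<rightarrow>\<^bsub>T\<^esub> y"
      then have y: "y \<in> verts T" using adj_in_verts by auto
      with adj have **: "(i - pos y) + (pos y - i) + height y = 1"
        using adj_iff[of "P ! i" y] nth_in_verts[of i] i by auto
      have h: "height y = 0"
      proof (rule ccontr)
        assume "height y \<noteq> 0"
        then show False using off_path[OF y] ** i by auto
      qed
      then have "pos y = j" using ** i(3)[of "pos y"] pos_le[OF y] by auto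
      then show "y = P ! j" using on_path[OF y h] by simp
    qed (use i adj_P[OF i(1,2)] in auto)
    then show ?thesis by (simp add: out_degree_eq_card)
  qed
  show "deg T (P ! 0) = 1" by (rule *[of 0 1]) (use d_ge_2 in auto)
  show "deg T (P ! d) = 1" by (rule *[of d "d - 1"]) (use d_ge_2 in auto)
qed

lemma leaves_eq: "leaves T = verts T - (!) P ` {1..<d}"
proof -
  have "x \<in> (!) P ` {1..<d} \<longleftrightarrow> deg T x \<noteq> 1" if x: "x \<in> verts T" for x
  proof (cases "height x = 0")
    case True
    then have *: "pos x \<le> d" "P ! pos x = x" using on_path x by auto
    have "x \<in> (!) P ` {1..<d} \<longleftrightarrow> pos x \<in> {1..<d}"
    proof
      assume "pos x \<in> {1..<d}"
      then show "x \<in> (!) P ` {1..<d}" using *(2) by (intro image_eqI[of _ _ "pos x"]) simp_all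
    qed auto
    moreover have "deg T x \<noteq> 1 \<longleftrightarrow> pos x \<in> {1..<d}"
    proof (cases "pos x \<in> {1..<d}")
      case True
      then show ?thesis using deg_on_path[of "pos x"] * by auto
    next
      case False
      then have "pos x = 0 \<or> pos x = d" using * by auto
      then show ?thesis using False deg_ends * by auto
    qed
    ultimately show ?thesis by simp
  next
    case False
    then have "x \<notin> (!) P ` {1..<d}" using height_nth by auto
    then show ?thesis using deg_off_path[OF x False] by simp
  qed
  then show ?thesis by (auto simp: leaves_def)
qed

lemma adjacent_leaves_inner:
  assumes "1 \<le> i" "i < d"
  shows "adjacent_leaves T (P ! i) = pendant i \<union> {x. x = P ! 0 \<and> i = 1} \<union> {x. x = P ! d \<and> i = d - 1}"
proof (rule set_eqI)
  fix x
  have "P ! i \<rightarrow>\<^bsub>T\<^esub> x \<longleftrightarrow> (i - pos x) + (pos x - i) + height x = 1" if "x \<in> verts T"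
    using assms adj_iff[OF nth_in_verts that, of i] by simp
  then have "x \<in> adjacent_leaves T (P ! i) \<longleftrightarrow> x \<in> verts T \<and> x \<notin> (!) P ` {1..<d} \<and> (i - pos x) + (pos x - i) + height x = 1"
    unfolding adjacent_leaves_def leaves_eq mem_Collect_eq by fast
  also have "\<dots> \<longleftrightarrow> x \<in> pendant i \<union> {x. x = P ! 0 \<and> i = 1} \<union> {x. x = P ! d \<and> i = d - 1}"
  proof
    assume *: "x \<in> verts T \<and> x \<notin> (!) P ` {1..<d} \<and> (i - pos x) + (pos x - i) + height x = 1"
    show "x \<in> pendant i \<union> {x. x = P ! 0 \<and> i = 1} \<union> {x. x = P ! d \<and> i = d - 1}"
    proof (cases "height x = 0")
      case True
      then have **: "pos x \<le> d" "P ! pos x = x" using on_path * by auto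
      then have "pos x \<notin> {1..<d}" using * by (metis image_eqI)
      then have "pos x = 0 \<or> pos x = d" using ** by auto
      then show ?thesis using ** * assms by auto
    next
      case False
      then have "height x = 1" "pos x = i" using * by auto
      then show ?thesis using * by (auto simp: pendant_def)
    qed
  next
    assume "x \<in> pendant i \<union> {x. x = P ! 0 \<and> i = 1} \<union> {x. x = P ! d \<and> i = d - 1}"
    moreover have "P ! 0 \<notin> (!) P ` {1..<d}" "P ! d \<notin> (!) P ` {1..<d}"
      by auto
    ultimately show "x \<in> verts T \<and> x \<notin> (!) P ` {1..<d} \<and> (i - pos x) + (pos x - i) + height x = 1"
      using assms by (auto simp: pendant_def nth_in_verts)
  qed
  finally show "x \<in> adjacent_leaves T (P ! i) \<longleftrightarrow> x \<in> pendant i \<union> {x. x = P ! 0 \<and> i = 1} \<union> {x. x = P ! d \<and> i = d - 1}" .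
qed

text \<open>The indicators count the two ends of the path, which are leaves as well. Both are 1 only
  for \<open>d = 2\<close>, where 1 and \<open>d - 1\<close> coincide.\<close>

lemma card_adjacent_leaves:
  assumes "1 \<le> i" "i < d"
  shows "card (adjacent_leaves T (P ! i)) = card (pendant i) + of_bool (i = 1) + of_bool (i = d - 1)"
proof -
  have "P ! 0 \<notin> pendant i" "P ! d \<notin> pendant i" "P ! 0 \<noteq> P ! d" using d_ge_2 by simp_all
  then show ?thesis unfolding adjacent_leaves_inner[OF assms]
    by (cases "i = 1"; cases "i = d - 1") auto
qed

text \<open>Condition (iii) ranges over all positions, ends included. An end is adjacent to an inner
  path vertex only, so it never qualifies there.\<close>

lemma adjacent_leaves_ends: "adjacent_leaves T (P ! 0) = {}" "adjacent_leaves T (P ! d) = {}"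
proof -
  have "x \<in> (!) P ` {1..<d}" if "P ! i \<rightarrow>\<^bsub>T\<^esub> x" "i = 0 \<or> i = d" for i x
  proof -
    have x: "x \<in> verts T" using that adj_in_verts by auto
    have "(i - pos x) + (pos x - i) + height x = 1"
      using that adj_iff[of "P ! i" x] x nth_in_verts[of i] by auto
    moreover from this have "height x = 0"
      using off_path[OF x] that(2) by (cases "height x = 0") auto
    ultimately have "pos x \<in> {1..<d}" "x = P ! pos x"
      using that(2) on_path[OF x] d_ge_2 by auto
    then show ?thesis by blast
  qed
  then show "adjacent_leaves T (P ! 0) = {}" "adjacent_leaves T (P ! d) = {}"
    unfolding adjacent_leaves_def leaves_eq by auto
qed

end


subsection \<open>Diametrical paths of a caterpillar\<close>

text \<open>The path of non-leaves as a list, with adjacency expressed by indices; this avoids the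
  induced subgraph of \<open>caterpillar\<close>.\<close>

definition backbone :: "('a, 'b) pre_digraph \<Rightarrow> 'a list \<Rightarrow> bool" where
  "backbone T p \<longleftrightarrow> p \<noteq> [] \<and> distinct p \<and> set p = verts T - leaves T \<and>
    (\<forall>i<length p. \<forall>j<length p. p ! i \<rightarrow>\<^bsub>T\<^esub> p ! j \<longleftrightarrow> j = i + 1 \<or> i = j + 1)"

lemma caterpillar_graph: "caterpillar T \<Longrightarrow> graph T"
  by (simp add: caterpillar_def undirected_tree_def)

lemma (in wf_digraph) dominates_induce_subgraph_iff:
  "u \<rightarrow>\<^bsub>G \<restriction> S\<^esub> v \<longleftrightarrow> u \<rightarrow>\<^bsub>G\<^esub> v \<and> u \<in> S \<and> v \<in> S"
  by (auto simp: arcs_ends_conv induce_subgraph_def)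

text \<open>Turns the unordered pairs of \<open>path_graph\<close> into indices, which distinctness
  makes possible.\<close>

lemma nth_Suc_doubleton_iff:
  assumes "distinct p" "i < length p" "j < length p"
  shows "(\<exists>k. Suc k < length p \<and> {p ! i, p ! j} = {p ! k, p ! Suc k}) \<longleftrightarrow> j = i + 1 \<or> i = j + 1"
proof
  assume "\<exists>k. Suc k < length p \<and> {p ! i, p ! j} = {p ! k, p ! Suc k}"
  then obtain k where "Suc k < length p" "{p ! i, p ! j} = {p ! k, p ! Suc k}" by blast
  then show "j = i + 1 \<or> i = j + 1"
    using assms by (auto simp: doubleton_eq_iff nth_eq_iff_index_eq)
next
  assume "j = i + 1 \<or> i = j + 1"
  then show "\<exists>k. Suc k < length p \<and> {p ! i, p ! j} = {p ! k, p ! Suc k}"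
    using assms by (metis Suc_eq_plus1 insert_commute)
qed

lemma caterpillar_backbone:
  assumes "caterpillar T"
  shows "\<exists>p. backbone T p"
proof -
  interpret graph T using assms by (rule caterpillar_graph)
  let ?H = "T \<restriction> (verts T - leaves T)"
  obtain p where p: "p \<noteq> []" "distinct p" "verts ?H = set p"
    and adj: "\<And>u v. u \<rightarrow>\<^bsub>?H\<^esub> v \<longleftrightarrow> (\<exists>i. Suc i < length p \<and> {u, v} = {p ! i, p ! Suc i})"
    using assms unfolding caterpillar_def path_graph_def by blast
  have set: "set p = verts T - leaves T" using p(3) by simp
  have "p ! i \<rightarrow>\<^bsub>T\<^esub> p ! j \<longleftrightarrow> j = i + 1 \<or> i = j + 1" if "i < length p" "j < length p" for i j
  proof -
    have "p ! i \<rightarrow>\<^bsub>T\<^esub> p ! j \<longleftrightarrow> p ! i \<rightarrow>\<^bsub>?H\<^esub> p ! j"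
      using nth_mem[OF that(1)] nth_mem[OF that(2)] set by (simp add: dominates_induce_subgraph_iff)
    then show ?thesis using nth_Suc_doubleton_iff[OF p(2) that] by (simp only: adj)
  qed
  then show ?thesis unfolding backbone_def using p(1,2) set by blast
qed

text \<open>By connectedness a nonempty set closed under adjacency contains all vertices. Applied to
  one or two vertices, this excludes isolated vertices and pairs of adjacent leaves.\<close>

lemma caterpillar_closed_card:
  assumes "caterpillar T" "S \<subseteq> verts T" "S \<noteq> {}"
    and closed: "\<And>u v. u \<in> S \<Longrightarrow> u \<rightarrow>\<^bsub>T\<^esub> v \<Longrightarrow> v \<in> S"
  shows "3 \<le> card S"
proof -
  interpret graph T using assms(1) by (rule caterpillar_graph)
  have conn: "connected T" using assms(1) by (simp add: caterpillar_def undirected_tree_def)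
  obtain s where s: "s \<in> S" using assms(3) by blast
  have "verts T \<subseteq> S"
  proof
    fix v assume "v \<in> verts T"
    then have "s \<rightarrow>\<^sup>*\<^bsub>T\<^esub> v"
      using symmetric_connected_imp_strongly_connected[OF sym_arcs conn] s assms(2)
      by (auto simp: strongly_connected_def)
    then show "v \<in> S"
      by (induction rule: reachable_induct) (use s closed in auto)
  qed
  then show ?thesis using assms(1,2) unfolding caterpillar_def by (metis subset_antisym)
qed

lemma caterpillar_deg_pos:
  assumes "caterpillar T" "v \<in> verts T"
  shows "deg T v \<noteq> 0"
proof
  interpret graph T using assms(1) by (rule caterpillar_graph)
  assume "deg T v = 0"
  moreover have "finite {w. v \<rightarrow>\<^bsub>T\<^esub> w}"
    by (rule finite_subset[OF _ finite_verts]) (auto dest: adj_in_verts)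
  ultimately have "\<not> v \<rightarrow>\<^bsub>T\<^esub> w" for w by (auto simp: out_degree_eq_card)
  then show False using caterpillar_closed_card[OF assms(1), of "{v}"] assms(2) by auto
qed

lemma leaf_neighbour:
  assumes "caterpillar T" "l \<in> leaves T"
  obtains u where "u \<in> verts T - leaves T" "\<And>y. l \<rightarrow>\<^bsub>T\<^esub> y \<longleftrightarrow> y = u"
proof -
  interpret graph T using assms(1) by (rule caterpillar_graph)
  have nbr: "\<exists>u. \<forall>y. l \<rightarrow>\<^bsub>T\<^esub> y \<longleftrightarrow> y = u" if "l \<in> leaves T" for l
  proof -
    have "card {y. l \<rightarrow>\<^bsub>T\<^esub> y} = 1" using that by (simp add: leaves_def out_degree_eq_card)
    then obtain u where "{y. l \<rightarrow>\<^bsub>T\<^esub> y} = {u}" by (rule card_1_singletonE)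
    then show ?thesis by blast
  qed
  obtain u where u: "\<forall>y. l \<rightarrow>\<^bsub>T\<^esub> y \<longleftrightarrow> y = u" using nbr[OF assms(2)] by blast
  have ul: "u \<rightarrow>\<^bsub>T\<^esub> l" using u arcs_ends_symmetric[OF sym_arcs] by blast
  have "u \<notin> leaves T"
  proof
    assume "u \<in> leaves T"
    then have "v \<in> {l, u}" if "x \<in> {l, u}" "x \<rightarrow>\<^bsub>T\<^esub> v" for x v
      using nbr[of u] u ul that by auto
    moreover have "{l, u} \<subseteq> verts T" using ul adj_in_verts by auto
    ultimately have "3 \<le> card {l, u}"
      using caterpillar_closed_card[OF assms(1), of "{l, u}"] by blast
    then show False using card_insert_le_m1[of 2 "{u}" l] by (auto simp: card_insert_if split: if_splits)
  qed
  then show thesis using that[of u] u ul adj_in_verts(1) by blast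
qed

text \<open>A backbone is extended by a leaf at each end, which shifts the indices of
  \<open>p\<close> by one. Adjacency at the new ends is settled because a leaf has only one
  neighbour, and every vertex left out is a leaf hanging on \<open>p\<close>.\<close>

lemma caterpillar_pathI:
  assumes cat: "caterpillar T" and bb: "backbone T p"
    and a: "a \<in> leaves T" "a \<rightarrow>\<^bsub>T\<^esub> hd p" and b: "b \<in> leaves T" "b \<rightarrow>\<^bsub>T\<^esub> last p"
    and "a \<noteq> b"
  shows "caterpillar_path T (a # p @ [b]) (length p + 1)"
proof -
  interpret graph T using cat by (rule caterpillar_graph)
  note p = bb[unfolded backbone_def]
  let ?Q = "a # p @ [b]" and ?m = "length p"
  have m: "1 \<le> ?m" using p by (cases p) auto
  have Q: "?Q ! 0 = a" "?Q ! (?m + 1) = b" "?Q ! Suc 0 = hd p" "?Q ! ?m = last p"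
    using p m by (auto simp: nth_append hd_conv_nth last_conv_nth nth_Cons')
  have inner: "?Q ! i = p ! (i - 1)" if "1 \<le> i" "i \<le> ?m" for i
    using that by (auto simp: nth_append nth_Cons')
  have dist: "distinct ?Q" using p a b \<open>a \<noteq> b\<close> by auto
  have eq: "?Q ! i = ?Q ! j \<longleftrightarrow> i = j" if "i \<le> ?m + 1" "j \<le> ?m + 1" for i j
    using dist that by (subst nth_eq_iff_index_eq) auto
  have aQ: "a \<rightarrow>\<^bsub>T\<^esub> ?Q ! j \<longleftrightarrow> j = 1" if "j \<le> ?m + 1" for j
    using leaf_neighbour[OF cat a(1)] a(2) eq[OF that, of 1] m Q(3)
    by (metis One_nat_def le_add2)
  have bQ: "b \<rightarrow>\<^bsub>T\<^esub> ?Q ! j \<longleftrightarrow> j = ?m" if "j \<le> ?m + 1" for j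
    using leaf_neighbour[OF cat b(1)] b(2) eq[OF that, of "?m"] m Q(4)
    by (metis le_add1)
  have sym: "u \<rightarrow>\<^bsub>T\<^esub> v \<longleftrightarrow> v \<rightarrow>\<^bsub>T\<^esub> u" for u v
    using arcs_ends_symmetric[OF sym_arcs] by blast
  show ?thesis
  proof
    show "length ?Q = ?m + 1 + 1" "2 \<le> ?m + 1" "distinct ?Q" using m dist by auto
    show "set ?Q \<subseteq> verts T" using p a b by (auto simp: leaves_def)
  next
    fix i j assume ij: "i \<le> ?m + 1" "j \<le> ?m + 1"
    consider "i = 0" | "i = ?m + 1" | "j = 0" | "j = ?m + 1" | "1 \<le> i" "i \<le> ?m" "1 \<le> j" "j \<le> ?m"
      using ij by linarith
    then show "?Q ! i \<rightarrow>\<^bsub>T\<^esub> ?Q ! j \<longleftrightarrow> j = i + 1 \<or> i = j + 1"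
    proof cases
      case 1
      show ?thesis unfolding 1 Q using aQ[OF ij(2)] by linarith
    next
      case 2
      show ?thesis unfolding 2 Q using bQ[OF ij(2)] ij by linarith
    next
      case 3
      show ?thesis unfolding 3 Q sym[of _ a] using aQ[OF ij(1)] by linarith
    next
      case 4
      show ?thesis unfolding 4 Q sym[of _ b] using bQ[OF ij(1)] ij by linarith
    next
      case 5
      have "p ! (i - 1) \<rightarrow>\<^bsub>T\<^esub> p ! (j - 1) \<longleftrightarrow> j - 1 = i - 1 + 1 \<or> i - 1 = j - 1 + 1"
        using p 5 by auto
      then show ?thesis unfolding inner[OF 5(1,2)] inner[OF 5(3,4)] using 5 by linarith
    qed
  next
    fix x assume "x \<in> verts T" "x \<notin> set ?Q"
    then have x: "x \<in> leaves T" using p by auto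
    obtain u where u: "u \<in> verts T - leaves T" "\<And>y. x \<rightarrow>\<^bsub>T\<^esub> y \<longleftrightarrow> y = u"
      using leaf_neighbour[OF cat x] by metis
    then obtain i where "i < ?m" "u = p ! i" using p by (metis in_set_conv_nth)
    then show "\<exists>i\<ge>1. i < ?m + 1 \<and> (\<forall>y. x \<rightarrow>\<^bsub>T\<^esub> y \<longleftrightarrow> y = ?Q ! i)"
      using u(2) inner[of "i + 1"] by (intro exI[of _ "i + 1"]) auto
  qed
qed

text \<open>Provides a path for computing the diameter through \<open>diam_eq\<close>. A non-leaf
  has two neighbours, and an end of the backbone has at most one inside it, so a leaf hangs on each
  end; a backbone of one vertex supplies both leaves itself.\<close>

lemma ex_caterpillar_path:
  assumes cat: "caterpillar T" and bb: "backbone T p"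
  shows "\<exists>Q. caterpillar_path T Q (length p + 1)"
proof -
  interpret graph T using cat by (rule caterpillar_graph)
  note p = bb[unfolded backbone_def]
  have sym: "u \<rightarrow>\<^bsub>T\<^esub> v \<longleftrightarrow> v \<rightarrow>\<^bsub>T\<^esub> u" for u v
    using arcs_ends_symmetric[OF sym_arcs] by blast
  have two: "\<exists>y. v \<rightarrow>\<^bsub>T\<^esub> y \<and> y \<noteq> x" if "v \<in> set p" for v x
  proof (rule ccontr)
    assume "\<not> ?thesis"
    then have sub: "{y. v \<rightarrow>\<^bsub>T\<^esub> y} \<subseteq> {x}" by blast
    then have "deg T v \<le> 1"
      unfolding out_degree_eq_card using card_mono[OF _ sub] by simp
    moreover have "deg T v \<noteq> 0" "deg T v \<noteq> 1"
      using that p caterpillar_deg_pos[OF cat] by (auto simp: leaves_def)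
    ultimately show False by linarith
  qed
  have leaf: "y \<in> leaves T" if "v \<rightarrow>\<^bsub>T\<^esub> y" "y \<notin> set p" for v y
    using that p adj_in_verts(2)[OF that(1)] by blast
  show ?thesis
  proof (cases "length p = 1")
    case True
    then obtain v where v: "p = [v]" by (auto simp: length_Suc_conv)
    have nv: "\<not> v \<rightarrow>\<^bsub>T\<^esub> v" using adj_not_same by blast
    obtain a where a: "v \<rightarrow>\<^bsub>T\<^esub> a" "a \<noteq> v" using two[of v v] v by auto
    obtain b where b: "v \<rightarrow>\<^bsub>T\<^esub> b" "b \<noteq> a" using two[of v a] v by auto
    have "b \<noteq> v" using b nv by auto
    then have "caterpillar_path T (a # p @ [b]) (length p + 1)"
      using a b v leaf sym by (intro caterpillar_pathI[OF cat bb]) auto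
    then show ?thesis by blast
  next
    case False
    let ?m = "length p"
    have m: "2 \<le> ?m" using False p by (cases p; cases "tl p") auto
    have adj: "p ! i \<rightarrow>\<^bsub>T\<^esub> p ! j \<longleftrightarrow> j = i + 1 \<or> i = j + 1" if "i < ?m" "j < ?m" for i j
      using p that by blast
    have out: "\<exists>y. p ! i \<rightarrow>\<^bsub>T\<^esub> y \<and> y \<in> leaves T"
      if i: "i < ?m" and only: "\<And>k. k < ?m \<Longrightarrow> k = i + 1 \<or> i = k + 1 \<Longrightarrow> k = j" for i j
    proof -
      obtain y where y: "p ! i \<rightarrow>\<^bsub>T\<^esub> y" "y \<noteq> p ! j" using two[OF nth_mem[OF i]] by blast
      have "y \<notin> set p"
      proof
        assume "y \<in> set p"
        then obtain k where "k < ?m" "y = p ! k" by (metis in_set_conv_nth)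
        then show False using y adj[OF i, of k] only[of k] by auto
      qed
      then show ?thesis using y leaf by blast
    qed
    obtain a where a: "p ! 0 \<rightarrow>\<^bsub>T\<^esub> a" "a \<in> leaves T" using out[of 0 1] m by fastforce
    obtain b where b: "p ! (?m - 1) \<rightarrow>\<^bsub>T\<^esub> b" "b \<in> leaves T" using out[of "?m - 1" "?m - 2"] m by fastforce
    have "p ! 0 \<noteq> p ! (?m - 1)" using p m by (subst nth_eq_iff_index_eq) auto
    then have "a \<noteq> b"
      using a b leaf_neighbour[OF cat a(2)] sym by metis
    then have "caterpillar_path T (a # p @ [b]) (length p + 1)"
      using a b sym p by (intro caterpillar_pathI[OF cat bb]) (auto simp: hd_conv_nth last_conv_nth)
    then show ?thesis by blast
  qed
qed

lemma (in wf_digraph) card_ge_2_if_two_neighbours: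
  assumes "finite (verts G)" "v \<rightarrow>\<^bsub>G\<^esub> x" "v \<rightarrow>\<^bsub>G\<^esub> y" "x \<noteq> y"
  shows "2 \<le> card {w. v \<rightarrow>\<^bsub>G\<^esub> w}"
proof -
  have "finite {w. v \<rightarrow>\<^bsub>G\<^esub> w}"
    by (rule finite_subset[OF _ assms(1)]) (auto dest: adj_in_verts)
  then have "card {x, y} \<le> card {w. v \<rightarrow>\<^bsub>G\<^esub> w}" using assms by (intro card_mono) auto
  then show ?thesis using assms(4) by simp
qed

text \<open>Inner vertices of \<open>P\<close> have two neighbours, so none is a leaf. They are as
  many as the vertices of the backbone \<open>q\<close>, hence all of them, and a comparison of
  edges makes the interior of \<open>P\<close> a backbone itself. The ends are then the leaves
  required by \<open>caterpillar_pathI\<close>.\<close>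

lemma diametrical_caterpillar_path:
  assumes cat: "caterpillar T" and P: "vpath P T" "vwalk_length P = diam T"
  shows "caterpillar_path T P (diam T)"
proof -
  interpret graph T using cat by (rule caterpillar_graph)
  have sym: "u \<rightarrow>\<^bsub>T\<^esub> v \<longleftrightarrow> v \<rightarrow>\<^bsub>T\<^esub> u" for u v
    using arcs_ends_symmetric[OF sym_arcs] by blast
  obtain q where q: "backbone T q" using caterpillar_backbone[OF cat] by blast
  note q' = q[unfolded backbone_def]
  let ?m = "length q"
  have diam: "diam T = ?m + 1"
    using ex_caterpillar_path[OF cat q] caterpillar_path.diam_eq by blast
  have m: "1 \<le> ?m" using q' by (cases q) auto
  have walk: "vwalk P T" and dist: "distinct P" using P(1) by auto
  have len: "length P = ?m + 2" using P(2) diam by simp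
  define p where "p = butlast (tl P)"
  have p_len: "length p = ?m" using len by (simp add: p_def)
  have p_nth: "p ! i = P ! Suc i" if "i < ?m" for i
    using that len by (auto simp: p_def nth_butlast nth_tl)
  have P_eq: "P = P ! 0 # p @ [P ! (?m + 1)]"
    using len p_len p_nth by (intro nth_equalityI) (auto simp: nth_Cons' nth_append less_Suc_eq)
  have step: "P ! i \<rightarrow>\<^bsub>T\<^esub> P ! Suc i" if "i \<le> ?m" for i
    using vwalk_nth_adjacent[OF walk] that len by simp
  have distinct_p: "distinct p" using dist by (simp add: p_def distinct_tl distinct_butlast)
  have "set p \<subseteq> set q"
  proof
    fix x assume "x \<in> set p"
    then obtain i where i: "i < ?m" "x = P ! Suc i" using p_len p_nth by (metis in_set_conv_nth)
    have "P ! i \<noteq> P ! (i + 2)" using dist len i by (subst nth_eq_iff_index_eq) auto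
    moreover have "x \<rightarrow>\<^bsub>T\<^esub> P ! i" "x \<rightarrow>\<^bsub>T\<^esub> P ! (i + 2)"
      using step[of i] step[of "Suc i"] i sym by auto
    ultimately have "2 \<le> deg T x"
      using card_ge_2_if_two_neighbours[OF finite_verts] by (simp add: out_degree_eq_card)
    moreover have "x \<in> verts T" using \<open>x \<rightarrow>\<^bsub>T\<^esub> P ! i\<close> adj_in_verts by auto
    ultimately show "x \<in> set q" using q' by (auto simp: leaves_def)
  qed
  moreover have "card (set p) = card (set q)"
    using q' distinct_p p_len by (metis distinct_card)
  ultimately have set_p: "set p = set q" by (simp add: card_subset_eq)
  \<comment> \<open>The interior of \<open>P\<close> uses as many edges between non-leaves as there are, hence all of them.\<close>
  define E where "E r = (\<lambda>i. {r ! i, r ! Suc i}) ` {..<?m - 1}" for r :: "'a list"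
  have E_iff: "e \<in> E r \<longleftrightarrow> (\<exists>n. Suc n < ?m \<and> e = {r ! n, r ! Suc n})" for e r
    unfolding E_def image_iff by (metis lessThan_iff less_diff_conv Suc_eq_plus1)
  have "E p \<subseteq> E q"
  proof
    fix e assume "e \<in> E p"
    then obtain i where i: "i < ?m - 1" "e = {p ! i, p ! Suc i}" by (auto simp: E_def)
    then have "p ! i \<in> set q" "p ! Suc i \<in> set q" using p_len set_p by (metis less_diff_conv nth_mem Suc_eq_plus1 add_lessD1)+
    then obtain j k where jk: "j < ?m" "k < ?m" "p ! i = q ! j" "p ! Suc i = q ! k"
      by (metis in_set_conv_nth)
    have "p ! i \<rightarrow>\<^bsub>T\<^esub> p ! Suc i" using step[of "Suc i"] i p_nth by simp
    then have "k = j + 1 \<or> j = k + 1" using q' jk by metis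
    then show "e \<in> E q" using jk i(2) by (auto simp: E_def insert_commute)
  qed
  moreover have "card (E q) \<le> ?m - 1"
    unfolding E_def using card_image_le[of "{..<?m - 1}"] by simp
  moreover have "card (E p) = ?m - 1"
  proof -
    have "inj_on (\<lambda>i. {p ! i, p ! Suc i}) {..<?m - 1}"
      using distinct_p p_len by (intro inj_onI) (auto simp: doubleton_eq_iff nth_eq_iff_index_eq)
    then show ?thesis unfolding E_def by (simp add: card_image)
  qed
  ultimately have E_eq: "E p = E q"
    by (intro card_seteq) (auto simp: E_def)
  have "backbone T p"
    unfolding backbone_def
  proof (intro conjI allI impI)
    show "p \<noteq> []" using p_len m by auto
    show "set p = verts T - leaves T" using set_p q' by simp
    fix i j assume ij: "i < length p" "j < length p"
    have in_q: "p ! i \<in> set q" "p ! j \<in> set q"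
      using nth_mem[OF ij(1)] nth_mem[OF ij(2)] by (simp_all only: set_p)
    have "p ! i \<rightarrow>\<^bsub>T\<^esub> p ! j \<longleftrightarrow> {p ! i, p ! j} \<in> E q"
    proof -
      obtain k l where kl: "k < ?m" "l < ?m" "p ! i = q ! k" "p ! j = q ! l"
        using in_q by (metis in_set_conv_nth)
      have "q ! k \<rightarrow>\<^bsub>T\<^esub> q ! l \<longleftrightarrow> l = k + 1 \<or> k = l + 1" "distinct q"
        using q' kl(1,2) by simp_all
      then have "p ! i \<rightarrow>\<^bsub>T\<^esub> p ! j \<longleftrightarrow> (\<exists>n. Suc n < ?m \<and> {q ! k, q ! l} = {q ! n, q ! Suc n})"
        by (simp only: kl(3,4) nth_Suc_doubleton_iff[OF _ kl(1,2)])
      then show ?thesis unfolding E_iff kl(3,4) .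
    qed
    also have "\<dots> \<longleftrightarrow> (\<exists>n. Suc n < length p \<and> {p ! i, p ! j} = {p ! n, p ! Suc n})"
      unfolding E_eq[symmetric] E_iff p_len ..
    finally show "p ! i \<rightarrow>\<^bsub>T\<^esub> p ! j \<longleftrightarrow> j = i + 1 \<or> i = j + 1"
      using nth_Suc_doubleton_iff[OF distinct_p ij] by simp
  qed (rule distinct_p)
  moreover have "P ! 0 \<in> leaves T" "P ! (?m + 1) \<in> leaves T"
  proof -
    have "distinct (P ! 0 # p @ [P ! (?m + 1)])" using dist P_eq by simp
    then have "P ! 0 \<notin> set p" "P ! (?m + 1) \<notin> set p" by auto
    moreover have "P ! 0 \<in> verts T" "P ! (?m + 1) \<in> verts T"
      using walk len nth_mem[of _ P] by (auto simp: vwalk_def)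
    ultimately show "P ! 0 \<in> leaves T" "P ! (?m + 1) \<in> leaves T" using set_p q' by auto
  qed
  moreover have "P ! 0 \<rightarrow>\<^bsub>T\<^esub> hd p" "P ! (?m + 1) \<rightarrow>\<^bsub>T\<^esub> last p"
  proof -
    have "p \<noteq> []" using p_len m by auto
    then have "hd p = P ! 1" "last p = P ! ?m"
      using m p_len p_nth[of 0] p_nth[of "?m - 1"] by (cases ?m; simp add: hd_conv_nth last_conv_nth)+
    then show "P ! 0 \<rightarrow>\<^bsub>T\<^esub> hd p" "P ! (?m + 1) \<rightarrow>\<^bsub>T\<^esub> last p"
      using step[of 0] step[of ?m] sym by auto
  qed
  moreover have "P ! 0 \<noteq> P ! (?m + 1)" using dist len by (subst nth_eq_iff_index_eq) auto
  ultimately have "caterpillar_path T (P ! 0 # p @ [P ! (?m + 1)]) (length p + 1)"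
    by (intro caterpillar_pathI[OF cat])
  then show ?thesis using P_eq p_len diam by simp
qed


subsection \<open>Private neighbours\<close>

text \<open>Lowering a value above 1 by one loses only vertices at distance exactly
  \<open>f v\<close>. Lowering it from 1 switches \<open>v\<close> off, so that \<open>v\<close>
  itself may be lost too; hence the exception.\<close>

definition private_neighbour :: "('a, 'b) pre_digraph \<Rightarrow> ('a \<Rightarrow> nat) \<Rightarrow> 'a \<Rightarrow> 'a \<Rightarrow> bool" where
  "private_neighbour G f v u \<longleftrightarrow> u \<in> verts G \<and> graph_dist G u v \<le> f v \<and>
    (graph_dist G u v = f v \<or> f v = 1) \<and>
    (\<forall>w\<in>verts G. w \<noteq> v \<longrightarrow> 1 \<le> f w \<longrightarrow> f w < graph_dist G u w)"

lemma broadcast_mono: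
  assumes "broadcast G f" "g \<in> extensional (verts G)" "\<And>v. v \<in> verts G \<Longrightarrow> g v \<le> f v"
  shows "broadcast G g"
proof -
  have "g v \<le> diam G \<and> g v \<le> eccentricity G v" if v: "v \<in> verts G" for v
  proof -
    have "f v \<le> diam G" "f v \<le> eccentricity G v"
      using assms(1) v by (auto simp: broadcast_def PiE_iff)
    then show ?thesis using assms(3)[OF v] by simp
  qed
  then show ?thesis using assms(2) by (auto simp: broadcast_def PiE_iff)
qed

text \<open>Minimality is tested by lowering a single value by one: a vertex that loses domination
  is a private neighbour. Conversely, by extensionality a smaller broadcast is strictly smaller at
  some vertex, whose private neighbour it leaves undominated.\<close>

lemma minimal_dominating_broadcast_iff:
  "minimal_dominating_broadcast G f \<longleftrightarrow> dominating_broadcast G f \<and>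
    (\<forall>v\<in>verts G. 1 \<le> f v \<longrightarrow> (\<exists>u. private_neighbour G f v u))"
proof (cases "dominating_broadcast G f")
  case dom: True
  then have br: "broadcast G f" by (simp add: dominating_broadcast_def)
  show ?thesis
  proof (intro iffI conjI ballI impI)
    fix v assume min: "minimal_dominating_broadcast G f" and v: "v \<in> verts G" "1 \<le> f v"
    define g where "g = f(v := f v - 1)"
    have "g \<noteq> f" using v by (auto simp: g_def fun_eq_iff intro!: exI[of _ v])
    moreover have le: "\<forall>w\<in>verts G. g w \<le> f w" by (simp add: g_def)
    ultimately have "\<not> dominating_broadcast G g"
      using min unfolding minimal_dominating_broadcast_def by blast
    moreover have "broadcast G g"
      using br le v(1) by (intro broadcast_mono[OF br]) (auto simp: g_def broadcast_def PiE_iff extensional_def)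
    ultimately obtain u where u: "u \<in> verts G"
      and g_u: "\<And>w. w \<in> verts G \<Longrightarrow> 1 \<le> g w \<Longrightarrow> g w < graph_dist G u w"
      unfolding dominating_broadcast_def by (meson not_le)
    have others: "f w < graph_dist G u w" if "w \<in> verts G" "w \<noteq> v" "1 \<le> f w" for w
      using g_u[OF that(1)] that by (simp add: g_def)
    obtain w where w: "w \<in> verts G" "1 \<le> f w" "graph_dist G u w \<le> f w"
      using dom u unfolding dominating_broadcast_def by blast
    then have "w = v" using others[of w] by force
    moreover have "f v = 1 \<or> f v - 1 < graph_dist G u v"
      using g_u[OF v(1)] v(2) by (cases "f v = 1") (auto simp: g_def)
    ultimately have "graph_dist G u v \<le> f v" "graph_dist G u v = f v \<or> f v = 1"
      using w by auto
    then show "\<exists>u. private_neighbour G f v u"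
      unfolding private_neighbour_def using u others by blast
  next
    assume priv: "dominating_broadcast G f \<and> (\<forall>v\<in>verts G. 1 \<le> f v \<longrightarrow> (\<exists>u. private_neighbour G f v u))"
    have False if g: "g \<noteq> f" "\<forall>v\<in>verts G. g v \<le> f v" "dominating_broadcast G g" for g
    proof -
      have "g \<in> extensional (verts G)" "f \<in> extensional (verts G)"
        using br g(3) by (auto simp: dominating_broadcast_def broadcast_def PiE_iff)
      then obtain v where v: "v \<in> verts G" "g v \<noteq> f v" using g(1) extensionalityI by metis
      then have less: "g v < f v" using g(2) by (simp add: le_neq_implies_less)
      then obtain u where u: "u \<in> verts G" "graph_dist G u v = f v \<or> f v = 1"
        "\<And>w. w \<in> verts G \<Longrightarrow> w \<noteq> v \<Longrightarrow> 1 \<le> f w \<Longrightarrow> f w < graph_dist G u w"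
        using priv v(1) unfolding private_neighbour_def by (metis One_nat_def less_imp_Suc_add Suc_leI zero_less_Suc)
      obtain w where w: "w \<in> verts G" "1 \<le> g w" "graph_dist G u w \<le> g w"
        using g(3) u(1) unfolding dominating_broadcast_def by blast
      then have "1 \<le> f w" "graph_dist G u w \<le> f w" using g(2) order_trans by blast+
      then have "w = v" using u(3)[OF w(1)] by force
      then show False using w u(2) less by auto
    qed
    then show "minimal_dominating_broadcast G f"
      using dom unfolding minimal_dominating_broadcast_def by blast
  qed (rule dom)
qed (auto simp: minimal_dominating_broadcast_def)

context caterpillar_path
begin

lemma minimal_dominating_broadcastI:
  assumes ext: "f \<in> extensional (verts T)"
    and le: "\<And>v. v \<in> verts T \<Longrightarrow> f v \<le> eccentricity T v"
    and dom: "\<And>u. u \<in> verts T \<Longrightarrow> \<exists>v\<in>verts T. 1 \<le> f v \<and> graph_dist T u v \<le> f v"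
    and priv: "\<And>v. v \<in> verts T \<Longrightarrow> 1 \<le> f v \<Longrightarrow> \<exists>u. private_neighbour T f v u"
  shows "minimal_dominating_broadcast T f"
proof -
  have "f v \<le> d" if "v \<in> verts T" for v using le[OF that] eccentricity_le[OF that] by simp
  then have "broadcast T f" using ext le by (auto simp: broadcast_def PiE_iff diam_eq)
  then show ?thesis
    using dom priv by (auto simp: minimal_dominating_broadcast_iff dominating_broadcast_def)
qed

text \<open>Extensionality and bounded values leave finitely many broadcasts, which gives the
  \<open>Max\<close> over costs its meaning.\<close>

lemma finite_costs: "finite {cost T f | f. minimal_dominating_broadcast T f}"
proof -
  have "{cost T f | f. minimal_dominating_broadcast T f} \<subseteq> cost T ` (verts T \<rightarrow>\<^sub>E {0..diam T})"
    by (auto simp: minimal_dominating_broadcast_def dominating_broadcast_def broadcast_def)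
  then show ?thesis by (rule finite_subset) (intro finite_imageI finite_PiE, simp_all)
qed

text \<open>One end of the path broadcasts with value \<open>d\<close> and has the other end as
  private neighbour. Hence equality with the diameter means that no minimal dominating broadcast
  costs more.\<close>

lemma ex_minimal_dominating_broadcast_cost_diam:
  "\<exists>f. minimal_dominating_broadcast T f \<and> cost T f = d"
proof -
  define f where "f = (\<lambda>v\<in>verts T. if v = P ! 0 then d else 0)"
  have v0: "P ! 0 \<in> verts T" and vd: "P ! d \<in> verts T" by (simp_all add: nth_in_verts)
  have f0: "f (P ! 0) = d" using v0 by (simp add: f_def)
  have f_pos: "v = P ! 0" if "v \<in> verts T" "1 \<le> f v" for v
    using that by (auto simp: f_def split: if_splits)
  have "minimal_dominating_broadcast T f"
  proof (rule minimal_dominating_broadcastI)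
    show "f \<in> extensional (verts T)" by (simp add: f_def)
    show "f v \<le> eccentricity T v" if "v \<in> verts T" for v
      using that eccentricity_ends by (simp add: f_def)
    show "\<exists>v\<in>verts T. 1 \<le> f v \<and> graph_dist T u v \<le> f v" if "u \<in> verts T" for u
      using v0 f0 d_ge_2 graph_dist_le[OF that v0] by (intro bexI[of _ "P ! 0"]) auto
    fix v assume v: "v \<in> verts T" "1 \<le> f v"
    have "v = P ! 0" using f_pos v by blast
    moreover have "graph_dist T (P ! d) (P ! 0) = d"
      using d_ge_2 by (simp add: graph_dist_eq[OF vd v0])
    ultimately have "private_neighbour T f v (P ! d)"
      unfolding private_neighbour_def using vd f0 f_pos by auto
    then show "\<exists>u. private_neighbour T f v u" by blast
  qed
  moreover have "cost T f = d"
    unfolding cost_def f_def using v0 by (simp add: sum.delta)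
  ultimately show ?thesis by blast
qed

lemma upper_broadcast_number_ge:
  "minimal_dominating_broadcast T f \<Longrightarrow> cost T f \<le> upper_broadcast_number T"
  unfolding upper_broadcast_number_def by (rule Max_ge[OF finite_costs]) blast

lemma upper_broadcast_number_eq_diam_iff:
  "upper_broadcast_number T = diam T \<longleftrightarrow> (\<forall>f. minimal_dominating_broadcast T f \<longrightarrow> cost T f \<le> d)"
proof
  assume "upper_broadcast_number T = diam T"
  then show "\<forall>f. minimal_dominating_broadcast T f \<longrightarrow> cost T f \<le> d"
    using upper_broadcast_number_ge diam_eq by auto
next
  assume *: "\<forall>f. minimal_dominating_broadcast T f \<longrightarrow> cost T f \<le> d"
  show "upper_broadcast_number T = diam T"
    unfolding upper_broadcast_number_def diam_eq
    by (rule Max_eqI[OF finite_costs]) (use * ex_minimal_dominating_broadcast_cost_diam in auto)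
qed

end


subsection \<open>Charging broadcasts to edges of the path\<close>

text \<open>In the next two lemmas \<open>X\<close> and \<open>Z\<close> are positions of broadcasting vertices and \<open>Y\<close> and \<open>U\<close> those of
  their private neighbours, respectively.\<close>

lemma spans_disjoint:
  fixes X Y Z U hx hy hz hu :: int
  assumes h: "hx = 0 \<or> hx = 1" "hy = 0 \<or> hy = 1" "hz = 0 \<or> hz = 1" "hu = 0 \<or> hu = 1"
    and "\<bar>X - Y\<bar> + hx + hy < \<bar>X - U\<bar> + hx + hu"
    and "\<bar>Z - U\<bar> + hz + hu < \<bar>Z - Y\<bar> + hz + hy"
    and "hx = 1 \<Longrightarrow> hz = 1 \<Longrightarrow> \<bar>X - Z\<bar> \<noteq> 1" "hx = 1 \<Longrightarrow> hu = 1 \<Longrightarrow> \<bar>X - U\<bar> \<noteq> 1"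
      "hy = 1 \<Longrightarrow> hz = 1 \<Longrightarrow> \<bar>Y - Z\<bar> \<noteq> 1" "hy = 1 \<Longrightarrow> hu = 1 \<Longrightarrow> \<bar>Y - U\<bar> \<noteq> 1"
  shows "(if X \<le> Y then Y + hy else X + hx) \<le> (if Z \<le> U then Z - hz else U - hu) \<or>
    (if Z \<le> U then U + hu else Z + hz) \<le> (if X \<le> Y then X - hx else Y - hy)"
  using assms by smt

lemma span_avoids:
  fixes X Y Z hx hy hz :: int
  assumes "hx = 0 \<or> hx = 1" "hy = 0 \<or> hy = 1" "hz = 0 \<or> hz = 1"
    and "\<bar>X - Y\<bar> + hx + hy < \<bar>X - Z\<bar> + hx + hz" "2 \<le> \<bar>Y - Z\<bar> + hy + hz"
    and "hx = 1 \<Longrightarrow> hz = 1 \<Longrightarrow> \<bar>X - Z\<bar> \<noteq> 1" "hy = 1 \<Longrightarrow> hz = 1 \<Longrightarrow> \<bar>Y - Z\<bar> \<noteq> 1"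
  shows "(if X \<le> Y then Y + hy else X + hx) < Z \<or> Z < (if X \<le> Y then X - hx else Y - hy)"
  using assms by smt

context caterpillar_path
begin

definition leaf_count :: "nat \<Rightarrow> nat" where
  "leaf_count i = card (pendant i) + of_bool (i = 1) + of_bool (i = d - 1)"

text \<open>The edge between positions \<open>i\<close> and \<open>i + 1\<close> has number \<open>i\<close>. A vertex with broadcast value 1 that is its
  own private neighbour is charged to the edge on its left or right. Two leaves at the same position
  take both, which forces everything to the right of them to move rightward until two adjacent
  positions without off-path leaves leave an edge free. The left end of the path counts as the first leaf
  at position 1, and truncated subtraction charges it to edge 0.\<close>

definition chained :: "nat \<Rightarrow> bool" where
  "chained i \<longleftrightarrow> (\<exists>j\<ge>1. j < i \<and> 2 \<le> leaf_count j \<and>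
    (\<forall>k. j < k \<and> k < i \<longrightarrow> pendant k \<noteq> {} \<or> pendant (k + 1) \<noteq> {}))"

definition first_leaf :: "nat \<Rightarrow> 'a" where
  "first_leaf i = (if i = 1 then P ! 0 else SOME x. x \<in> pendant i)"

definition rightward :: "'a \<Rightarrow> bool" where
  "rightward x \<longleftrightarrow> pos x < d \<and> (chained (pos x) \<or> height x = 1 \<and> x \<noteq> first_leaf (pos x))"

definition edge_of :: "'a \<Rightarrow> nat" where
  "edge_of x = (if rightward x then pos x else pos x - 1)"

lemma edge_of_less: "x \<in> verts T \<Longrightarrow> edge_of x < d"
  using pos_le[of x] d_ge_2 by (auto simp: edge_of_def rightward_def)

lemma first_leaf_pendant: "x \<in> pendant i \<Longrightarrow> i \<noteq> 1 \<Longrightarrow> first_leaf i \<in> pendant i"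
  by (auto simp: first_leaf_def intro: someI)

lemma pendant_pos: "x \<in> pendant i \<Longrightarrow> x \<in> verts T \<and> height x = 1 \<and> pos x = i \<and> 1 \<le> i \<and> i < d"
  using off_path[of x] by (auto simp: pendant_def)

lemma card_pendant_ge_2: "x \<in> pendant i \<Longrightarrow> y \<in> pendant i \<Longrightarrow> x \<noteq> y \<Longrightarrow> 2 \<le> card (pendant i)"
  using card_mono[of "pendant i" "{x, y}"] by auto

text \<open>The first leaf is a second one beside \<open>x\<close>: the left end at position 1, an
  off-path leaf elsewhere.\<close>

lemma leaf_count_ge_2:
  assumes "x \<in> pendant i" "x \<noteq> first_leaf i"
  shows "2 \<le> leaf_count i"
proof (cases "i = 1")
  case True
  then have "1 \<le> card (pendant i)" using assms(1) card_gt_0_iff[of "pendant i"] by fastforce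
  then show ?thesis using True by (simp add: leaf_count_def)
next
  case False
  then show ?thesis
    using card_pendant_ge_2[OF assms(1) first_leaf_pendant[OF assms(1) False] assms(2)]
    by (simp add: leaf_count_def)
qed

lemma graph_dist_pos:
  assumes "x \<in> verts T" "y \<in> verts T" "x \<noteq> y"
  shows "1 \<le> graph_dist T x y"
  using assms on_path_inj[of x y]
  by (cases "pos x = pos y"; cases "height x = 0"; cases "height y = 0") (auto simp: graph_dist_eq)

lemma graph_dist_commute: "x \<in> verts T \<Longrightarrow> y \<in> verts T \<Longrightarrow> graph_dist T x y = graph_dist T y x"
  by (simp add: graph_dist_eq)

text \<open>If \<open>x\<close> and \<open>y\<close> are distinct, this interval of edges has exactly as many elements as their distance,
  since it extends beyond the ends at which \<open>x\<close> or \<open>y\<close> is off the path.\<close>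

definition span :: "'a \<Rightarrow> 'a \<Rightarrow> nat set" where
  "span x y = (if pos x \<le> pos y then {pos x - height x..<pos y + height y}
    else {pos y - height y..<pos x + height x})"

text \<open>Off-path leaves never hang on an end, so extending a span neither truncates a
  subtraction nor, by the next lemma, leaves the \<open>d\<close> edges.\<close>

lemma height_le_pos: "x \<in> verts T \<Longrightarrow> height x \<le> pos x"
  using off_path[of x] by (cases "height x = 0") auto

lemma pos_height_le: "x \<in> verts T \<Longrightarrow> pos x + height x \<le> d"
  using off_path[of x] pos_le[of x] by (cases "height x = 0") auto

lemma int_graph_dist: "x \<in> verts T \<Longrightarrow> y \<in> verts T \<Longrightarrow> x \<noteq> y \<Longrightarrow>
    int (graph_dist T x y) = \<bar>int (pos x) - int (pos y)\<bar> + int (height x) + int (height y)"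
  by (auto simp: graph_dist_eq)

lemma span_subset: "x \<in> verts T \<Longrightarrow> y \<in> verts T \<Longrightarrow> span x y \<subseteq> {..<d}"
  using pos_height_le[of x] pos_height_le[of y] by (auto simp: span_def)

lemma card_span: "x \<in> verts T \<Longrightarrow> y \<in> verts T \<Longrightarrow> x \<noteq> y \<Longrightarrow> card (span x y) = graph_dist T x y"
  using height_le_pos[of x] height_le_pos[of y] by (auto simp: span_def graph_dist_eq)

lemma int_height: "int (height x) = 0 \<or> int (height x) = 1"
  using height_le_1[of x] by linarith

context
  assumes few: "\<And>i. 1 \<le> i \<Longrightarrow> i < d \<Longrightarrow> leaf_count i \<le> 2"
    and isolated: "\<And>i. 1 \<le> i \<Longrightarrow> i + 1 < d \<Longrightarrow> pendant i = {} \<or> pendant (i + 1) = {}"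
    and separated: "\<And>i j. 1 \<le> i \<Longrightarrow> i < j \<Longrightarrow> j < d \<Longrightarrow> 2 \<le> leaf_count i \<Longrightarrow> 2 \<le> leaf_count j \<Longrightarrow>
      \<exists>k. i < k \<and> k < j \<and> pendant k = {} \<and> pendant (k + 1) = {}"
begin

text \<open>A chain from \<open>j\<close> to \<open>i\<close> meets no two consecutive positions
  without off-path leaves, so \<open>separated\<close> forbids two leaves at both of its
  ends.\<close>

lemma chained_leaf_count: "chained i \<Longrightarrow> i < d \<Longrightarrow> leaf_count i < 2"
  unfolding chained_def by (meson separated not_le)

lemma pendant_not_adjacent: "x \<in> pendant i \<Longrightarrow> y \<in> pendant j \<Longrightarrow> j \<noteq> i + 1"
  using isolated[of i] pendant_pos[of x i] pendant_pos[of y j] by auto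

text \<open>A collision needs equal or consecutive positions. At equal positions one leaf moves left
  and the other right; at consecutive ones \<open>x\<close> would have to move right and
  \<open>y\<close> left, but moving right propagates along the chain.\<close>

lemma edge_of_neq_aux:
  assumes x: "x \<in> verts T" and y: "y \<in> verts T" and "x \<noteq> y"
    and dist: "2 \<le> graph_dist T x y" and le: "pos x \<le> pos y"
  shows "edge_of x \<noteq> edge_of y"
proof
  assume eq: "edge_of x = edge_of y"
  have sep: "2 \<le> (pos y - pos x) + height x + height y"
    using dist le \<open>x \<noteq> y\<close> by (simp add: graph_dist_eq[OF x y])
  have pend: "z \<in> pendant (pos z)" if "height z \<noteq> 0" "z \<in> verts T" for z
    using that off_path by (auto simp: pendant_def)
  have "pos y \<le> pos x + 1" using eq le by (auto simp: edge_of_def split: if_splits)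
  then consider "pos y = pos x" | "pos y = pos x + 1" using le by linarith
  then show False
  proof cases
    case 1
    define i where "i = pos x"
    have "height x \<noteq> 0" "height y \<noteq> 0"
      using sep 1 height_le_1[of x] height_le_1[of y] by auto
    then have xi: "x \<in> pendant i" and yi: "y \<in> pendant i"
      using pend[of x] pend[of y] x y 1 by (auto simp: i_def)
    have i: "1 \<le> i" "i < d" using pendant_pos[OF xi] by auto
    have two: "2 \<le> card (pendant i)" using card_pendant_ge_2[OF xi yi \<open>x \<noteq> y\<close>] .
    \<comment> \<open>At position 1 the left end would be a third leaf. Hence
      \<open>first_leaf i\<close> is one of \<open>x\<close> and \<open>y\<close>, and only the
      other one moves right.\<close>
    then have i1: "i \<noteq> 1" "card (pendant i) = 2" "\<not> chained i"
      using few[OF i] chained_leaf_count[of i] i by (auto simp: leaf_count_def)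
    have "pendant i = {x, y}"
      using i1(2) xi yi \<open>x \<noteq> y\<close> by (intro card_seteq[symmetric]) auto
    then have "first_leaf i = x \<or> first_leaf i = y" using first_leaf_pendant[OF xi i1(1)] by auto
    then have "rightward x \<noteq> rightward y"
      using i i1(3) pendant_pos[OF xi] pendant_pos[OF yi] \<open>x \<noteq> y\<close> by (auto simp: rightward_def)
    then show False using eq i 1 by (auto simp: edge_of_def i_def split: if_splits)
  next
    case 2
    define i where "i = pos x"
    have hh: "height x \<noteq> 0 \<or> height y \<noteq> 0" using sep 2 by auto
    show False
    \<comment> \<open>Truncation charges the left end to edge 0, as it counts as the first leaf of
      position 1; the off-path leaf \<open>y\<close> there must move right.\<close>
    proof (cases "i = 0")
      case True
      then have "height x = 0" using off_path[OF x] by (auto simp: i_def)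
      then have hy: "height y \<noteq> 0" using hh by simp
      have "y \<in> pendant 1" using pend[OF hy y] 2 True by (simp add: i_def)
      then have "pos y < d" "height y = 1" "y \<noteq> first_leaf (pos y)"
        using pendant_pos[of y 1] by (auto simp: first_leaf_def)
      then have "rightward y" by (simp add: rightward_def)
      then show False using eq True 2 by (auto simp: edge_of_def i_def split: if_splits)
    next
      case False
      then have right: "rightward x" "\<not> rightward y"
        using eq 2 by (auto simp: edge_of_def i_def split: if_splits)
      have i: "1 \<le> i" "i < d" using False right by (auto simp: i_def rightward_def)
      have pendants: "pendant i \<noteq> {} \<or> pendant (i + 1) \<noteq> {}"
        using hh pend[OF _ x] pend[OF _ y] 2 by (auto simp: i_def)
      \<comment> \<open>Either the chain reaching \<open>i\<close> is prolonged, thanks to an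
        off-path leaf at one of the two positions, or \<open>x\<close> is a second leaf and
        \<open>i\<close> starts a new chain.\<close>
      have "chained (i + 1)"
      proof (cases "chained i")
        case True
        then obtain j where "1 \<le> j" "j < i" "2 \<le> leaf_count j"
          "\<forall>k. j < k \<and> k < i \<longrightarrow> pendant k \<noteq> {} \<or> pendant (k + 1) \<noteq> {}"
          unfolding chained_def by blast
        then show ?thesis
          unfolding chained_def using pendants by (intro exI[of _ j]) (auto simp: less_Suc_eq)
      next
        case False
        then have "height x = 1" "x \<noteq> first_leaf i"
          using right(1) by (auto simp: rightward_def i_def)
        then have "2 \<le> leaf_count i" using leaf_count_ge_2 pend[OF _ x] by (auto simp: i_def)
        then show ?thesis unfolding chained_def using i by (intro exI[of _ i]) auto
      qed
      \<comment> \<open>A chained \<open>y\<close> can fail to move right only as the right end.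
        Then \<open>x\<close>, the first leaf and this end are three leaves at position
        \<open>d - 1\<close>.\<close>
      then have "pos y = d"
        using right(2) 2 pos_le[OF y] by (auto simp: rightward_def i_def)
      then have hy: "height y = 0" and id: "i = d - 1"
        using off_path[OF y] 2 by (auto simp: i_def)
      then have hx: "height x \<noteq> 0" using hh by simp
      have xi: "x \<in> pendant i" using pend[OF hx x] by (simp add: i_def)
      then have "1 \<le> card (pendant i)" using card_gt_0_iff[of "pendant i"] by fastforce
      then have lc: "2 \<le> leaf_count i" using id by (simp add: leaf_count_def)
      then have "\<not> chained i" using chained_leaf_count i by fastforce
      then have nf: "x \<noteq> first_leaf i" using right(1) by (simp add: rightward_def i_def)
      show False
      proof (cases "i = 1")
        case True
        then show False using few[OF i] id \<open>1 \<le> card (pendant i)\<close> by (simp add: leaf_count_def)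
      next
        case False
        have "2 \<le> card (pendant i)"
          using card_pendant_ge_2[OF xi first_leaf_pendant[OF xi False] nf] .
        then show False using few[OF i] id by (simp add: leaf_count_def)
      qed
    qed
  qed
qed

lemma edge_of_neq:
  assumes "x \<in> verts T" "y \<in> verts T" "x \<noteq> y" "2 \<le> graph_dist T x y"
  shows "edge_of x \<noteq> edge_of y"
  using edge_of_neq_aux[of x y] edge_of_neq_aux[of y x] assms graph_dist_commute
  by (metis nat_le_linear)

lemma leaf_gap:
  assumes "x \<in> verts T" "y \<in> verts T"
  shows "int (height x) = 1 \<Longrightarrow> int (height y) = 1 \<Longrightarrow> \<bar>int (pos x) - int (pos y)\<bar> \<noteq> 1"
  using assms pendant_not_adjacent[of x "pos x" y "pos y"] pendant_not_adjacent[of y "pos y" x "pos x"]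
  by (auto simp: pendant_def)

text \<open>Neither broadcasting vertex reaches the private neighbour of the other, which separates
  the path segments. Their extensions could still meet if off-path leaves hung at consecutive
  positions, which \<open>leaf_gap\<close> excludes.\<close>

lemma span_disjoint:
  assumes v: "x \<in> verts T" "y \<in> verts T" "z \<in> verts T" "u \<in> verts T" and "x \<noteq> y" "z \<noteq> u"
    and 1: "graph_dist T x y < graph_dist T x u" and 2: "graph_dist T z u < graph_dist T z y"
  shows "span x y \<inter> span z u = {}"
proof -
  have ne: "x \<noteq> u" "z \<noteq> y" using 1 2 v by (auto simp: graph_dist_eq)
  have "int (graph_dist T x y) < int (graph_dist T x u)" "int (graph_dist T z u) < int (graph_dist T z y)"
    using 1 2 by simp_all
  then have "(if int (pos x) \<le> int (pos y) then int (pos y) + int (height y) else int (pos x) + int (height x))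
      \<le> (if int (pos z) \<le> int (pos u) then int (pos z) - int (height z) else int (pos u) - int (height u)) \<or>
    (if int (pos z) \<le> int (pos u) then int (pos u) + int (height u) else int (pos z) + int (height z))
      \<le> (if int (pos x) \<le> int (pos y) then int (pos x) - int (height x) else int (pos y) - int (height y))"
    using v ne \<open>x \<noteq> y\<close> \<open>z \<noteq> u\<close> leaf_gap
    by (intro spans_disjoint int_height) (simp_all only: int_graph_dist not_False_eq_True)
  then show ?thesis
    using v[THEN height_le_pos] by (auto simp: span_def split: if_splits)
qed

text \<open>Here \<open>z\<close> is its own private neighbour. Its position lies strictly beyond
  the span, so neither edge that \<open>edge_of\<close> may choose is contained in it.\<close>

lemma edge_of_notin_span:
  assumes v: "x \<in> verts T" "y \<in> verts T" "z \<in> verts T" and "x \<noteq> y"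
    and 1: "graph_dist T x y < graph_dist T x z" and 2: "2 \<le> graph_dist T y z"
  shows "edge_of z \<notin> span x y"
proof -
  have ne: "x \<noteq> z" "y \<noteq> z" using 1 2 v by (auto simp: graph_dist_eq)
  have "int (graph_dist T x y) < int (graph_dist T x z)" "2 \<le> int (graph_dist T y z)"
    using 1 2 by simp_all
  then have "(if int (pos x) \<le> int (pos y) then int (pos y) + int (height y) else int (pos x) + int (height x))
      < int (pos z) \<or>
    int (pos z) < (if int (pos x) \<le> int (pos y) then int (pos x) - int (height x) else int (pos y) - int (height y))"
    using v ne \<open>x \<noteq> y\<close> leaf_gap
    by (intro span_avoids[where hz = "int (height z)"] int_height) (simp_all only: int_graph_dist not_False_eq_True)
  then show ?thesis
    using v[THEN height_le_pos] by (auto simp: span_def edge_of_def split: if_splits)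
qed

lemma cost_le:
  assumes "minimal_dominating_broadcast T f"
  shows "cost T f \<le> d"
proof -
  define S where "S = {v \<in> verts T. 1 \<le> f v}"
  have "\<forall>v\<in>S. \<exists>u. private_neighbour T f v u"
    using assms by (auto simp: minimal_dominating_broadcast_iff S_def)
  then obtain q where q: "\<And>v. v \<in> S \<Longrightarrow> private_neighbour T f v (q v)" by metis
  have SV: "v \<in> verts T" "1 \<le> f v" "q v \<in> verts T" if "v \<in> S" for v
    using that q[OF that] by (auto simp: S_def private_neighbour_def)
  have priv: "f w < graph_dist T w (q v)" if "v \<in> S" "w \<in> S" "w \<noteq> v" for v w
    using q[OF that(1)] SV[OF that(1)] SV[OF that(2)] that(3) graph_dist_commute
    by (auto simp: private_neighbour_def)
  define E where "E v = (if q v = v then {edge_of v} else span v (q v))" for v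
  have self: "f v = 1" if "v \<in> S" "q v = v" for v
    using q[OF that(1)] SV[OF that(1)] that(2) by (auto simp: private_neighbour_def graph_dist_eq)
  \<comment> \<open>For \<open>f v = 1\<close> a private neighbour other than \<open>v\<close> is at
    distance exactly 1, so the exception disappears.\<close>
  have other: "f v = graph_dist T v (q v)" if "v \<in> S" "q v \<noteq> v" for v
  proof -
    have "1 \<le> graph_dist T v (q v)"
      using SV[OF that(1)] that(2) by (intro graph_dist_pos) auto
    then show ?thesis
      using q[OF that(1)] graph_dist_commute[of v "q v"] SV[OF that(1)]
      by (auto simp: private_neighbour_def)
  qed
  have card_E: "card (E v) = f v" if "v \<in> S" for v
    using self[OF that] other[OF that] card_span[of v "q v"] SV[OF that] by (auto simp: E_def)
  have E_sub: "E v \<subseteq> {..<d}" if "v \<in> S" for v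
    using SV[OF that] span_subset edge_of_less by (auto simp: E_def)
  have disj: "E v \<inter> E w = {}" if v: "v \<in> S" and w: "w \<in> S" and ne: "v \<noteq> w" for v w
  proof -
    note p1 = priv[OF v w ne[symmetric]] and p2 = priv[OF w v ne]
    note V = SV[OF v] and W = SV[OF w]
    consider "q v = v" "q w = w" | "q v = v" "q w \<noteq> w" | "q v \<noteq> v" "q w = w" | "q v \<noteq> v" "q w \<noteq> w"
      by blast
    then show ?thesis
    proof cases
      case 1
      then have "edge_of v \<noteq> edge_of w"
        using p2 V W ne by (intro edge_of_neq) auto
      then show ?thesis using 1 by (simp add: E_def)
    next
      case 2
      then have "edge_of v \<notin> span w (q w)"
        using p1 p2 V W ne self[OF v] other[OF w] graph_dist_commute[of "q w" v]
        by (intro edge_of_notin_span) auto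
      then show ?thesis using 2 by (simp add: E_def)
    next
      case 3
      then have "edge_of w \<notin> span v (q v)"
        using p1 p2 V W ne self[OF w] other[OF v] graph_dist_commute[of "q v" w]
        by (intro edge_of_notin_span) auto
      then show ?thesis using 3 by (simp add: E_def)
    next
      case 4
      then have "span v (q v) \<inter> span w (q w) = {}"
        using p1 p2 V W other[OF v] other[OF w] by (intro span_disjoint) auto
      then show ?thesis using 4 by (simp add: E_def)
    qed
  qed
  have "finite S" by (simp add: S_def)
  have "cost T f = (\<Sum>v\<in>S. f v)"
    unfolding cost_def S_def by (rule sum.mono_neutral_right) auto
  also have "\<dots> = (\<Sum>v\<in>S. card (E v))" using card_E by simp
  also have "\<dots> = card (\<Union>v\<in>S. E v)"
    using \<open>finite S\<close> disj finite_subset[OF E_sub]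
    by (intro card_UN_disjoint[symmetric]) auto
  also have "\<dots> \<le> card {..<d}"
    using E_sub by (intro card_mono) auto
  finally show ?thesis by simp
qed

end


subsection \<open>Broadcasts of cost greater than the diameter\<close>

lemma ends_in_verts: "P ! 0 \<in> verts T" "P ! d \<in> verts T"
  by (simp_all add: nth_in_verts)

lemma ends_neq: "P ! 0 \<noteq> P ! d"
  using d_ge_2 by simp

lemma graph_dist_left_end: "u \<in> verts T \<Longrightarrow> graph_dist T u (P ! 0) = pos u + height u"
  using ends_in_verts by (auto simp: graph_dist_eq)

lemma graph_dist_right_end: "u \<in> verts T \<Longrightarrow> graph_dist T u (P ! d) = d - pos u + height u"
  using ends_in_verts pos_le[of u] by (auto simp: graph_dist_eq)

text \<open>The ends broadcast \<open>i + 1\<close> and \<open>d - i\<close>, in total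
  \<open>d + 1\<close>. They just reach the off-path leaves at \<open>i\<close> and
  \<open>i + 1\<close>; each end misses the private neighbour of the other by one.\<close>

lemma ex_costly_broadcast_if_adjacent_pendants:
  assumes i: "1 \<le> i" "i + 1 < d" and a: "a \<in> pendant i" and b: "b \<in> pendant (i + 1)"
  shows "\<exists>f. minimal_dominating_broadcast T f \<and> d < cost T f"
proof -
  define f where "f = (\<lambda>v\<in>verts T. if v = P ! 0 then i + 1 else if v = P ! d then d - i else 0)"
  have f_ends: "f (P ! 0) = i + 1" "f (P ! d) = d - i"
    using ends_in_verts ends_neq by (auto simp: f_def)
  have f_pos: "v = P ! 0 \<or> v = P ! d" if "v \<in> verts T" "1 \<le> f v" for v
    using that by (auto simp: f_def split: if_splits)
  have a': "a \<in> verts T" "height a = 1" "pos a = i" and b': "b \<in> verts T" "height b = 1" "pos b = i + 1"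
    using a b by (auto simp: pendant_def)
  have "minimal_dominating_broadcast T f"
  proof (rule minimal_dominating_broadcastI)
    show "f \<in> extensional (verts T)" by (simp add: f_def)
    show "f v \<le> eccentricity T v" if "v \<in> verts T" for v
      using that eccentricity_ends i by (auto simp: f_def)
    fix u assume u: "u \<in> verts T"
    show "\<exists>v\<in>verts T. 1 \<le> f v \<and> graph_dist T u v \<le> f v"
    proof (cases "pos u \<le> i")
      case True
      then show ?thesis
        using height_le_1[of u] u f_ends ends_in_verts
        by (intro bexI[of _ "P ! 0"]) (auto simp: graph_dist_left_end)
    next
      case False
      then show ?thesis
        using height_le_1[of u] u f_ends ends_in_verts i pos_le[OF u]
        by (intro bexI[of _ "P ! d"]) (auto simp: graph_dist_right_end)
    qed
  next
    fix v assume v: "v \<in> verts T" "1 \<le> f v"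
    then consider "v = P ! 0" | "v = P ! d" using f_pos by blast
    then show "\<exists>u. private_neighbour T f v u"
    proof cases
      case 1
      have "graph_dist T a v = f v" "f (P ! d) < graph_dist T a (P ! d)"
        using 1 a' f_ends i by (simp_all add: graph_dist_left_end graph_dist_right_end)
      moreover have "w = P ! d" if "w \<in> verts T" "w \<noteq> v" "1 \<le> f w" for w
        using f_pos[OF that(1,3)] that(2) 1 by blast
      ultimately have "private_neighbour T f v a"
        using a' unfolding private_neighbour_def by fastforce
      then show ?thesis by blast
    next
      case 2
      have "graph_dist T b v = f v" "f (P ! 0) < graph_dist T b (P ! 0)"
        using 2 b' f_ends i by (simp_all add: graph_dist_left_end graph_dist_right_end)
      moreover have "w = P ! 0" if "w \<in> verts T" "w \<noteq> v" "1 \<le> f w" for w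
        using f_pos[OF that(1,3)] that(2) 2 by blast
      ultimately have "private_neighbour T f v b"
        using b' unfolding private_neighbour_def by fastforce
      then show ?thesis by blast
    qed
  qed
  moreover have "f (P ! 0) + f (P ! d) \<le> cost T f"
    unfolding cost_def using sum_mono2[of "verts T" "{P ! 0, P ! d}" f] ends_in_verts ends_neq by simp
  then have "d < cost T f" using f_ends i by simp
  ultimately show ?thesis by blast
qed

text \<open>The ends of the path dominate what lies to the left of \<open>i\<close> and to the right of \<open>j\<close>; all off-path leaves at
  even offset from \<open>i\<close> and all path vertices at odd offset broadcast with value 1. The case \<open>i = j\<close>
  refutes condition (i), the case \<open>i < j\<close> condition (iii).\<close>

lemma ex_costly_broadcast_if_alternating_block:
  assumes ij: "1 \<le> i" "i \<le> j" "j < d" and ev: "even (j - i)"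
    and block: "\<And>k. i \<le> k \<Longrightarrow> k \<le> j \<Longrightarrow> pendant k \<noteq> {} \<longleftrightarrow> even (k - i)"
    and single: "i = j \<Longrightarrow> 3 \<le> leaf_count i"
    and multi: "i < j \<Longrightarrow> 2 \<le> leaf_count i \<and> 2 \<le> leaf_count j"
  shows "\<exists>f. minimal_dominating_broadcast T f \<and> d < cost T f"
proof -
  define M where "M = {v \<in> verts T. i \<le> pos v \<and> pos v \<le> j \<and> (height v = 1 \<longleftrightarrow> even (pos v - i))}"
  \<comment> \<open>The left end must cover everything left of \<open>i\<close>. An off-path leaf at
    \<open>i - 1\<close> requires the value \<open>i\<close>; without one \<open>i - 1\<close>
    suffices, except for \<open>i = 1\<close>, where the value has to stay positive.
    \<open>B\<close> mirrors this.\<close>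
  define A where "A = (if i = 1 \<or> pendant (i - 1) \<noteq> {} then i else i - 1)"
  define B where "B = (if j = d - 1 \<or> pendant (j + 1) \<noteq> {} then d - j else d - j - 1)"
  define f where "f = (\<lambda>v\<in>verts T. if v = P ! 0 then A else if v = P ! d then B else of_bool (v \<in> M))"
  have A: "1 \<le> A" "A \<le> i" "i - 1 \<le> A" and B: "1 \<le> B" "B \<le> d - j" "d - j - 1 \<le> B"
    using ij by (auto simp: A_def B_def)
  have M: "v \<in> verts T" "i \<le> pos v" "pos v \<le> j" "height v = 1 \<longleftrightarrow> even (pos v - i)" if "v \<in> M" for v
    using that by (auto simp: M_def)
  have M_ends: "P ! 0 \<notin> M" "P ! d \<notin> M" using ij by (auto simp: M_def)
  have f_ends: "f (P ! 0) = A" "f (P ! d) = B"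
    using ends_in_verts ends_neq by (auto simp: f_def)
  have f_M: "f v = 1" if "v \<in> M" for v
    using that M[OF that] M_ends by (auto simp: f_def)
  have f_pos: "v = P ! 0 \<or> v = P ! d \<or> v \<in> M" if "v \<in> verts T" "1 \<le> f v" for v
    using that by (auto simp: f_def of_bool_def split: if_splits)
  \<comment> \<open>Since \<open>j - i\<close> is even, the block begins and ends with off-path
    leaves, so path vertices of \<open>M\<close> are strictly inside and also out of reach of both
    ends.\<close>
  have M_spine: "i + 1 \<le> pos v \<and> pos v + 1 \<le> j" if v: "v \<in> M" "height v \<noteq> 1" for v
  proof -
    have "odd (pos v - i)" using M(4)[OF v(1)] v(2) by blast
    then have "pos v \<noteq> i" "pos v \<noteq> j" using ev by auto
    then show ?thesis using M(2,3)[OF v(1)] by auto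
  qed
  have M_left: "i + 1 \<le> pos v + height v" and M_right: "d - j + 1 \<le> d - pos v + height v" if v: "v \<in> M" for v
    using M(2,3)[OF v] M_spine[OF v] ij(3) by (cases "height v = 1"; linarith)+
  have M_sep: "2 \<le> graph_dist T v w" if v: "v \<in> M" and w: "w \<in> M" and ne: "v \<noteq> w" for v w
  proof -
    note V = M[OF v] and W = M[OF w]
    consider "height v = 1" "height w = 1" | "height v \<noteq> height w" | "height v = 0" "height w = 0"
      using height_le_1[of v] height_le_1[of w] by linarith
    then show ?thesis
    proof cases
      case 1
      then show ?thesis using V(1) W(1) ne by (simp add: graph_dist_eq)
    next
      case 2
      then have "(height v = 1) \<noteq> (height w = 1)"
        using height_le_1[of v] height_le_1[of w] by linarith
      then have "pos v \<noteq> pos w" using V(4) W(4) by auto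
      then show ?thesis using 2 V(1) W(1) ne by (auto simp: graph_dist_eq)
    next
      case 3
      then have odd: "odd (pos v - i)" "odd (pos w - i)" using V(4) W(4) by auto
      have "pos v \<noteq> pos w" using 3 on_path_inj V(1) W(1) ne by blast
      moreover have "pos v \<noteq> pos w + 1" "pos w \<noteq> pos v + 1"
        using odd V(2) W(2) by (auto simp: Suc_diff_le)
      ultimately show ?thesis using V(1) W(1) ne by (auto simp: graph_dist_eq)
    qed
  qed
  have privateI: "private_neighbour T f v u"
    if "u \<in> verts T" "graph_dist T u v \<le> f v" "graph_dist T u v = f v \<or> f v = 1"
      "v \<noteq> P ! 0 \<Longrightarrow> A < graph_dist T u (P ! 0)" "v \<noteq> P ! d \<Longrightarrow> B < graph_dist T u (P ! d)"
      "\<And>w. w \<in> M \<Longrightarrow> w \<noteq> v \<Longrightarrow> 2 \<le> graph_dist T u w" for v u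
    unfolding private_neighbour_def
  proof (intro conjI ballI impI)
    fix w assume w: "w \<in> verts T" "w \<noteq> v" "1 \<le> f w"
    then consider "w = P ! 0" | "w = P ! d" | "w \<in> M" using f_pos by blast
    then show "f w < graph_dist T u w"
      using that(4-6) f_ends f_M w(2) by cases force+
  qed (use that in auto)
  have "minimal_dominating_broadcast T f"
  proof (rule minimal_dominating_broadcastI)
    show "f \<in> extensional (verts T)" by (simp add: f_def)
    show "f v \<le> eccentricity T v" if "v \<in> verts T" for v
      using that eccentricity_ends eccentricity_pos[OF that] A B ij by (auto simp: f_def)
    fix u assume u: "u \<in> verts T"
    have pend: "u \<in> pendant (pos u)" if "height u = 1" using u that by (simp add: pendant_def)
    consider "pos u < i" | "j < pos u" | "i \<le> pos u" "pos u \<le> j" by linarith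
    then show "\<exists>v\<in>verts T. 1 \<le> f v \<and> graph_dist T u v \<le> f v"
    proof cases
      case 1
      have "pos u + height u \<le> A"
      proof (cases "height u = 1 \<and> pos u = i - 1")
        case True
        then have "pendant (i - 1) \<noteq> {}" using pend by auto
        then show ?thesis using True ij by (simp add: A_def)
      next
        case False
        then show ?thesis using 1 A height_le_1[of u] by linarith
      qed
      then show ?thesis
        using f_ends A u ends_in_verts by (intro bexI[of _ "P ! 0"]) (auto simp: graph_dist_left_end)
    next
      case 2
      have "d - pos u + height u \<le> B"
      proof (cases "height u = 1 \<and> pos u = j + 1")
        case True
        then have "pendant (j + 1) \<noteq> {}" using pend by auto
        moreover have "pos u < d" using pendant_pos[OF pend] True by auto
        ultimately show ?thesis using True ij by (simp add: B_def)
      next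
        case False
        then show ?thesis using 2 B height_le_1[of u] off_path[OF u] pos_le[OF u]
          by (cases "height u = 0") auto
      qed
      then show ?thesis
        using f_ends B u ends_in_verts by (intro bexI[of _ "P ! d"]) (auto simp: graph_dist_right_end)
    next
      case 3
      show ?thesis
      proof (cases "u \<in> M")
        case True
        then show ?thesis using f_M[OF True] u by (intro bexI[of _ u]) (auto simp: graph_dist_eq)
      next
        case False
        \<comment> \<open>By \<open>block\<close> no off-path leaf sits at an odd offset, so
          \<open>u\<close> is a path vertex at an even offset and is dominated by a leaf hanging on
          it.\<close>
        have "height u = 0"
        proof (rule ccontr)
          assume "height u \<noteq> 0"
          then have h: "height u = 1" using height_le_1[of u] by linarith
          then have "even (pos u - i)" using block[OF 3] pend by auto
          then show False using False h u 3 by (simp add: M_def)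
        qed
        then have "even (pos u - i)" using False u 3 by (auto simp: M_def)
        then obtain l where l: "l \<in> pendant (pos u)" using block[OF 3] by auto
        then have "l \<in> M" "height l = 1" "pos l = pos u"
          using \<open>even (pos u - i)\<close> 3 by (auto simp: M_def pendant_def)
        then show ?thesis
          using f_M M(1) u \<open>height u = 0\<close> by (intro bexI[of _ l]) (auto simp: graph_dist_eq)
      qed
    qed
  next
    fix v assume v: "v \<in> verts T" "1 \<le> f v"
    have nbr: "P ! (i - 1) \<in> verts T" "P ! (j + 1) \<in> verts T" using ij nth_in_verts by auto
    consider "v = P ! 0" | "v = P ! d" | "v \<in> M" using v f_pos by blast
    then show "\<exists>u. private_neighbour T f v u"
    proof cases
      case 1
      \<comment> \<open>The cases of \<open>A\<close> determine the private neighbour: the end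
        itself, an off-path leaf at \<open>i - 1\<close>, or the path vertex there.\<close>
      consider "i = 1" | l where "i \<noteq> 1" "l \<in> pendant (i - 1)" | "i \<noteq> 1" "pendant (i - 1) = {}" by blast
      then show ?thesis
      proof cases
        case i: 1
        have "private_neighbour T f v (P ! 0)"
        proof (rule privateI)
          fix w assume "w \<in> M"
          then show "2 \<le> graph_dist T (P ! 0) w"
            using M_left[of w] i M(1)[of w] ends_in_verts M_ends
            by (subst graph_dist_commute) (auto simp: graph_dist_left_end)
        qed (use 1 i ends_in_verts f_ends A B ij in \<open>auto simp: graph_dist_left_end graph_dist_right_end\<close>)
        then show ?thesis by blast
      next
        case i: 2
        have l: "l \<in> verts T" "height l = 1" "pos l = i - 1" using i(2) by (auto simp: pendant_def)
        have "A = i" using i by (auto simp: A_def)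
        have "private_neighbour T f v l"
        proof (rule privateI)
          fix w assume "w \<in> M"
          then show "2 \<le> graph_dist T l w"
            using M(1,2)[of w] l ij by (auto simp: graph_dist_eq)
        qed (use 1 l f_ends \<open>A = i\<close> B ij in \<open>auto simp: graph_dist_left_end graph_dist_right_end\<close>)
        then show ?thesis by blast
      next
        case i: 3
        have "A = i - 1" using i by (auto simp: A_def)
        have "private_neighbour T f v (P ! (i - 1))"
        proof (rule privateI)
          fix w assume "w \<in> M"
          then show "2 \<le> graph_dist T (P ! (i - 1)) w"
            using M(1,2)[of w] M_left[of w] nbr ij by (auto simp: graph_dist_eq)
        qed (use 1 nbr f_ends \<open>A = i - 1\<close> B ij in \<open>auto simp: graph_dist_left_end graph_dist_right_end\<close>)
        then show ?thesis by blast
      qed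
    next
      case 2
      consider "j = d - 1" | l where "j \<noteq> d - 1" "l \<in> pendant (j + 1)" | "j \<noteq> d - 1" "pendant (j + 1) = {}" by blast
      then show ?thesis
      proof cases
        case i: 1
        have "private_neighbour T f v (P ! d)"
        proof (rule privateI)
          fix w assume "w \<in> M"
          then show "2 \<le> graph_dist T (P ! d) w"
            using M_right[of w] i M(1)[of w] ends_in_verts M_ends ij
            by (subst graph_dist_commute) (auto simp: graph_dist_right_end)
        qed (use 2 i ends_in_verts f_ends A B ij in \<open>auto simp: graph_dist_left_end graph_dist_right_end\<close>)
        then show ?thesis by blast
      next
        case i: 2
        have l: "l \<in> verts T" "height l = 1" "pos l = j + 1" using i(2) by (auto simp: pendant_def)
        have "B = d - j" using i by (auto simp: B_def)
        have "private_neighbour T f v l"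
        proof (rule privateI)
          fix w assume "w \<in> M"
          then show "2 \<le> graph_dist T l w"
            using M(1,3)[of w] l ij by (auto simp: graph_dist_eq)
        qed (use 2 l f_ends \<open>B = d - j\<close> A ij i(1) in \<open>auto simp: graph_dist_left_end graph_dist_right_end\<close>)
        then show ?thesis by blast
      next
        case i: 3
        have "B = d - j - 1" using i by (auto simp: B_def)
        have "private_neighbour T f v (P ! (j + 1))"
        proof (rule privateI)
          fix w assume "w \<in> M"
          then show "2 \<le> graph_dist T (P ! (j + 1)) w"
            using M(1,3)[of w] M_right[of w] nbr ij by (auto simp: graph_dist_eq)
        qed (use 2 nbr f_ends \<open>B = d - j - 1\<close> A ij i(1) in \<open>auto simp: graph_dist_left_end graph_dist_right_end\<close>)
        then show ?thesis by blast
      qed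
    next
      case 3
      have "private_neighbour T f v v"
      proof (rule privateI)
        fix w assume "w \<in> M" "w \<noteq> v"
        then show "2 \<le> graph_dist T v w" using M_sep 3 by blast
      qed (use 3 M(1)[OF 3] f_M[OF 3] M_left[OF 3] M_right[OF 3] A B in
          \<open>auto simp: graph_dist_left_end graph_dist_right_end graph_dist_eq\<close>)
      then show ?thesis by blast
    qed
  qed
  moreover have "d < cost T f"
  proof -
    have finM: "finite M" by (simp add: M_def)
    have slice: "pendant k \<subseteq> M" if "i \<le> k" "k \<le> j" "even (k - i)" for k
      using that by (auto simp: M_def pendant_def)
    have card_M: "card (pendant i) + card (pendant j) + (j - i - 1) \<le> card M" if "i < j"
    proof -
      \<comment> \<open>One vertex of \<open>M\<close> for each position strictly between
        \<open>i\<close> and \<open>j\<close>, in addition to the leaves at both ends of the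
        block.\<close>
      define m where "m k = (if even (k - i) then (SOME x. x \<in> pendant k) else P ! k)" for k
      have m: "m k \<in> M" "pos (m k) = k" if k: "i < k" "k < j" for k
      proof (atomize (full), cases "even (k - i)")
        case True
        then have "pendant k \<noteq> {}" using block[of k] k by simp
        then have "(SOME x. x \<in> pendant k) \<in> pendant k" by (simp add: some_in_eq)
        then show "m k \<in> M \<and> pos (m k) = k" using slice[of k] True k by (auto simp: m_def pendant_def)
      next
        case False
        then show "m k \<in> M \<and> pos (m k) = k" using k ij nth_in_verts by (auto simp: m_def M_def)
      qed
      have "inj_on m {i<..<j}"
        by (intro inj_on_inverseI[of _ pos]) (use m in auto)
      then have "card (m ` {i<..<j}) = j - i - 1" by (simp add: card_image)
      moreover have "m ` {i<..<j} \<inter> (pendant i \<union> pendant j) = {}"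
        using m by (fastforce simp: pendant_def)
      moreover have "pendant i \<inter> pendant j = {}" using that by (auto simp: pendant_def)
      ultimately have "card (m ` {i<..<j} \<union> (pendant i \<union> pendant j)) = j - i - 1 + (card (pendant i) + card (pendant j))"
        by (simp add: card_Un_disjoint)
      moreover have "m ` {i<..<j} \<union> (pendant i \<union> pendant j) \<subseteq> M"
        using m slice[of i] slice[of j] ev ij by auto
      ultimately show ?thesis
        using card_mono[OF finM, of "m ` {i<..<j} \<union> (pendant i \<union> pendant j)"] by linarith
    qed
    have "sum f (insert (P ! 0) (insert (P ! d) M)) \<le> cost T f"
      unfolding cost_def using ends_in_verts M(1) by (intro sum_mono2) auto
    then have "A + B + card M \<le> cost T f"
      using finM M_ends ends_neq f_ends f_M by simp
    \<comment> \<open>The indicators in \<open>leaf_count\<close> are matched by the surplus of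
      \<open>A\<close> over \<open>i - 1\<close> and of \<open>B\<close> over
      \<open>d - j - 1\<close>. The total is at least \<open>d - 2\<close> plus 3 for
      \<open>i = j\<close>, and at least \<open>d - 3\<close> plus 4 otherwise.\<close>
    moreover have "d < A + B + card M"
    proof (cases "i = j")
      case True
      have "card (pendant i) \<le> card M" using slice[of i] ij by (intro card_mono finM) auto
      moreover have "i - 1 + of_bool (i = 1) \<le> A" "d - i - 1 + of_bool (i = d - 1) \<le> B"
        using True ij by (auto simp: A_def B_def)
      ultimately show ?thesis using single[OF True] ij True by (simp add: leaf_count_def)
    next
      case False
      then have "i < j" using ij by simp
      moreover have "i - 1 + of_bool (i = 1) \<le> A" "d - j - 1 + of_bool (j = d - 1) \<le> B"
        using ij by (auto simp: A_def B_def)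
      moreover have "leaf_count i = card (pendant i) + of_bool (i = 1)"
        "leaf_count j = card (pendant j) + of_bool (j = d - 1)"
        using \<open>i < j\<close> ij by (auto simp: leaf_count_def)
      ultimately show ?thesis using card_M multi ij by linarith
    qed
    ultimately show ?thesis by linarith
  qed
  ultimately show ?thesis by blast
qed

section \<open>The characterization in coordinates and its translation to degrees and leaves\<close>

lemma cost_le_diam_iff:
  "(\<forall>f. minimal_dominating_broadcast T f \<longrightarrow> cost T f \<le> d) \<longleftrightarrow>
    (\<forall>i\<ge>1. i < d \<longrightarrow> leaf_count i \<le> 2) \<and>
    (\<forall>i\<ge>1. i + 1 < d \<longrightarrow> pendant i = {} \<or> pendant (i + 1) = {}) \<and>
    (\<forall>i\<ge>1. \<forall>j>i. j < d \<and> 2 \<le> leaf_count i \<and> 2 \<le> leaf_count j \<longrightarrow>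
      (\<exists>k. i < k \<and> k < j \<and> pendant k = {} \<and> pendant (k + 1) = {}))"
  (is "?bound \<longleftrightarrow> ?few \<and> ?isolated \<and> ?separated")
proof
  assume conds: "?few \<and> ?isolated \<and> ?separated"
  show ?bound
  proof (intro allI impI)
    fix f assume min: "minimal_dominating_broadcast T f"
    show "cost T f \<le> d"
      by (rule cost_le[OF _ _ _ min]) (use conds in simp_all)
  qed
next
  assume bound: ?bound
  have ?few
  proof (intro allI impI)
    fix i assume i: "1 \<le> i" "i < d"
    show "leaf_count i \<le> 2"
    proof (rule ccontr)
      assume "\<not> leaf_count i \<le> 2"
      moreover from this have "pendant i \<noteq> {}" by (auto simp: leaf_count_def of_bool_def split: if_splits)
      ultimately show False
        using ex_costly_broadcast_if_alternating_block[of i i] bound i by force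
    qed
  qed
  moreover have isolated: ?isolated
    using ex_costly_broadcast_if_adjacent_pendants bound by (metis ex_in_conv not_le)
  moreover have ?separated
  proof (intro allI impI, elim conjE)
    fix i j assume ij: "1 \<le> i" "i < j" "j < d" "2 \<le> leaf_count i" "2 \<le> leaf_count j"
    show "\<exists>k. i < k \<and> k < j \<and> pendant k = {} \<and> pendant (k + 1) = {}"
    proof (rule ccontr)
      assume none: "\<not> ?thesis"
      \<comment> \<open>Without off-path leaves both indicators would have to be 1, so
        \<open>d = 2\<close>, which leaves no room for \<open>i < j\<close>.\<close>
      have ends: "pendant i \<noteq> {}" "pendant j \<noteq> {}"
        using ij by (auto simp: leaf_count_def of_bool_def split: if_splits)
      \<comment> \<open>Consecutive positions are never both with off-path leaves by
        \<open>isolated\<close> and never both without by \<open>none\<close>, so they alternate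
        from \<open>i\<close> on. As \<open>j\<close> has such a leaf, \<open>j - i\<close> is
        even.\<close>
      have "t \<le> j - i \<Longrightarrow> pendant (i + t) \<noteq> {} \<longleftrightarrow> even t" for t
      proof (induction t)
        case 0
        then show ?case using ends by simp
      next
        case (Suc t)
        have "pendant (i + t) = {} \<or> pendant (i + t + 1) = {}"
          using isolated Suc.prems ij by simp
        moreover have "pendant (i + t) \<noteq> {} \<or> pendant (i + t + 1) \<noteq> {}"
          using none ends Suc.prems by (cases "t = 0") auto
        ultimately show ?case using Suc by auto
      qed
      then have block: "pendant k \<noteq> {} \<longleftrightarrow> even (k - i)" if "i \<le> k" "k \<le> j" for k
        using that by (metis diff_le_mono le_add_diff_inverse)
      have "\<exists>f. minimal_dominating_broadcast T f \<and> d < cost T f"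
        using ij block block[of j] ends by (intro ex_costly_broadcast_if_alternating_block[of i j]) auto
      then show False using bound by (meson not_le)
    qed
  qed
  ultimately show "?few \<and> ?isolated \<and> ?separated" by blast
qed

end

theorem theorem1p1:
  fixes T :: "('a, 'b) pre_digraph" and P :: "'a list" and d :: nat
  assumes "caterpillar T"
    and "d = diam T"
    and "vpath P T" and "vwalk_length P = d"
  shows "upper_broadcast_number T = diam T \<longleftrightarrow>
      (\<forall>i\<in>{1..d - 1}. card (adjacent_leaves T (P ! i)) \<le> 2)
    \<and> (\<forall>i\<in>{1..d - 2}. min (deg T (P ! i)) (deg T (P ! (i + 1))) = 2)
    \<and> (\<forall>i j. i < j \<and> j \<le> d
          \<and> card (adjacent_leaves T (P ! i)) \<ge> 2 \<and> card (adjacent_leaves T (P ! j)) \<ge> 2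
        \<longrightarrow> (\<exists>k. i < k \<and> k < j \<and> deg T (P ! k) = 2 \<and> deg T (P ! (k + 1)) = 2))"
proof -
  interpret caterpillar_path T P d
    using diametrical_caterpillar_path assms by metis
  have lc: "card (adjacent_leaves T (P ! i)) = leaf_count i" if "1 \<le> i" "i < d" for i
    using card_adjacent_leaves[OF that] by (simp add: leaf_count_def)
  have deg2: "deg T (P ! i) = 2 \<longleftrightarrow> pendant i = {}" if "1 \<le> i" "i < d" for i
    using deg_on_path[OF that] by simp
  have range: "k \<in> {1..d - 1} \<longleftrightarrow> 1 \<le> k \<and> k < d" "k \<in> {1..d - 2} \<longleftrightarrow> 1 \<le> k \<and> k + 1 < d" for k
    using d_ge_2 by auto
  have i: "(\<forall>i\<in>{1..d - 1}. card (adjacent_leaves T (P ! i)) \<le> 2) \<longleftrightarrow> (\<forall>i\<ge>1. i < d \<longrightarrow> leaf_count i \<le> 2)"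
    unfolding Ball_def range by (metis lc)
  have min2: "min (deg T (P ! i)) (deg T (P ! (i + 1))) = 2 \<longleftrightarrow> pendant i = {} \<or> pendant (i + 1) = {}"
    if "1 \<le> i" "i + 1 < d" for i
    using deg_on_path[of i] deg_on_path[of "i + 1"] that by (auto simp: min_def)
  have ii: "(\<forall>i\<in>{1..d - 2}. min (deg T (P ! i)) (deg T (P ! (i + 1))) = 2) \<longleftrightarrow>
      (\<forall>i\<ge>1. i + 1 < d \<longrightarrow> pendant i = {} \<or> pendant (i + 1) = {})"
    unfolding Ball_def range by (metis min2)
  \<comment> \<open>The theorem lets \<open>i\<close> and \<open>j\<close> be ends of the path;
    these have no adjacent leaves.\<close>
  have inner: "1 \<le> i \<and> j < d" if "i < j" "j \<le> d" "2 \<le> card (adjacent_leaves T (P ! i))"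
    "2 \<le> card (adjacent_leaves T (P ! j))" for i j
  proof -
    have "i \<noteq> 0" "j \<noteq> d" using that(3,4) adjacent_leaves_ends by (metis card.empty not_numeral_le_zero)+
    then show ?thesis using that by simp
  qed
  have iii: "(\<forall>i j. i < j \<and> j \<le> d
          \<and> card (adjacent_leaves T (P ! i)) \<ge> 2 \<and> card (adjacent_leaves T (P ! j)) \<ge> 2
        \<longrightarrow> (\<exists>k. i < k \<and> k < j \<and> deg T (P ! k) = 2 \<and> deg T (P ! (k + 1)) = 2)) \<longleftrightarrow>
    (\<forall>i\<ge>1. \<forall>j>i. j < d \<and> 2 \<le> leaf_count i \<and> 2 \<le> leaf_count j \<longrightarrow>
      (\<exists>k. i < k \<and> k < j \<and> pendant k = {} \<and> pendant (k + 1) = {}))" (is "?L \<longleftrightarrow> ?R")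
  proof -
    have eq: "(\<exists>k. i < k \<and> k < j \<and> deg T (P ! k) = 2 \<and> deg T (P ! (k + 1)) = 2) \<longleftrightarrow>
        (\<exists>k. i < k \<and> k < j \<and> pendant k = {} \<and> pendant (k + 1) = {})" if "1 \<le> i" "j < d" for i j
      using that deg2 by (intro ex_cong1 conj_cong) auto
    show ?thesis
    proof
      assume L: ?L
      show ?R
      proof (intro allI impI, elim conjE)
        fix i j assume "1 \<le> i" "i < j" "j < d" "2 \<le> leaf_count i" "2 \<le> leaf_count j"
        then show "\<exists>k. i < k \<and> k < j \<and> pendant k = {} \<and> pendant (k + 1) = {}"
          using L[rule_format, of i j] lc[of i] lc[of j] eq[of i j] by simp
      qed
    next
      assume R: ?R
      show ?L
      proof (intro allI impI, elim conjE)
        fix i j assume *: "i < j" "j \<le> d" "2 \<le> card (adjacent_leaves T (P ! i))"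
          "2 \<le> card (adjacent_leaves T (P ! j))"
        have "1 \<le> i" "j < d" using inner[OF *] by auto
        then show "\<exists>k. i < k \<and> k < j \<and> deg T (P ! k) = 2 \<and> deg T (P ! (k + 1)) = 2"
          using R[rule_format, of i j] lc[of i] lc[of j] eq[of i j] * by simp
      qed
    qed
  qed
  show ?thesis
    unfolding i ii iii upper_broadcast_number_eq_diam_iff by (rule cost_le_diam_iff)
qed

end
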